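(* Assume $\phi: \mathbb{E}_2 \to \mathbb{E}_2$ is a continuous sequential endomorphism, i.e., a continuous map satisfying $\phi(A\circ B)=\phi(A)\circ\phi(B)$ for all $A,B\in\mathbb{E}_2$. Then we have the following four possibilities (i.e., $\phi$ is of one of the following forms): \begin{itemize} \item[(d1)] there exists a unitary $U\in \mathbb{M}_2$ and a non-negative real number $c$ such that $\phi(A)=(\det A)^c\, UAU^*$ for all $A\in \mathbb{E}_2$; \item[(d2)] there exists a unitary $V\in \mathbb{M}_2$ such that $\phi(A)=V(\operatorname{adj} A)V^*$ for all $A\in \mathbb{E}_2$; \item[(d3)] there exists a unitary $V\in \mathbb{M}_2$ and a real number $d>1$ such that, for all $A\in\mathbb{E}_2$, $\phi(A)=(\det A)^d\, VA^{-1}V^*$ if $A$ is invertible, and $\phi(A)=0$ otherwise; \item[(d4)] there exists a unitary $W\in \mathbb{M}_2$ and non-negative real numbers $c_1, c_2$ such that $\phi(A)= W\,\mathrm{Diag}[(\det A)^{c_1}, (\det A)^{c_2}]\,W^*$ for all $A\in \mathbb{E}_2$. \end{itemize} Here $0^0$ means $1$.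
   Context: $\mathbb{M}_2$ denotes the algebra of all $2\times 2$ complex matrices. $\mathbb{E}_2$ denotes the set of all positive semi-definite matrices $A\in\mathbb{M}_2$ with $A\leq I$, where for self-adjoint matrices $A\le B$ means that $B-A$ is positive semi-definite. The sequential product on $\mathbb{E}_2$ is $A\circ B=A^{1/2}BA^{1/2}$, where $A^{1/2}$ is the positive semi-definite square root. Continuity is with respect to the topology of the operator norm (equivalently, of any norm on $\mathbb{M}_2$). $\operatorname{adj} A$ denotes the adjugate (classical adjoint) matrix of $A$, $\mathrm{Diag}[a,b]$ the $2\times 2$ diagonal matrix with diagonal entries $a,b$, and $U^*$ the conjugate transpose of $U$.
   Formalization: As stated the claim fails for maps with φ(I)≠I, e.g. φ=0, since (d1)–(d4) all send I to I; the formal theorem adds two further possibilities: φ(A)=W Diag[(det A)^c,0]W* with W unitary and c≥0, and φ=0. For φ(I)=I it gives exactly (d1)–(d4). *)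

theory Defs
  imports "HOL-Analysis.Analysis"
begin

definition conj_transpose :: "complex^'n^'m \<Rightarrow> complex^'m^'n" where
  "conj_transpose A = (\<chi> i j. cnj (A $ j $ i))"

definition unitary_matrix :: "complex^'n^'n \<Rightarrow> bool" where
  "unitary_matrix U \<longleftrightarrow> U ** conj_transpose U = mat 1 \<and> conj_transpose U ** U = mat 1"

definition self_adjoint :: "complex^'n^'n \<Rightarrow> bool" where
  "self_adjoint A \<longleftrightarrow> conj_transpose A = A"

(* The inner product on complex^'n provided by the library is the real one, so the sesquilinear
   form is written out. Its value is real for self-adjoint A. *)
definition pos_semidef :: "complex^'n^'n \<Rightarrow> bool" where
  "pos_semidef A \<longleftrightarrow>
     self_adjoint A \<and> (\<forall>x. 0 \<le> Re (\<Sum>i\<in>UNIV. cnj (x $ i) * (A *v x) $ i))"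

definition loewner_le :: "complex^'n^'n \<Rightarrow> complex^'n^'n \<Rightarrow> bool" where
  "loewner_le A B \<longleftrightarrow> self_adjoint A \<and> self_adjoint B \<and> pos_semidef (B - A)"

definition effects :: "(complex^'n^'n) set" where
  "effects = {A. pos_semidef A \<and> loewner_le A (mat 1)}"

definition pos_sqrt :: "complex^'n^'n \<Rightarrow> complex^'n^'n" where
  "pos_sqrt A = (THE S. pos_semidef S \<and> S ** S = A)"

definition seq_prod :: "complex^'n^'n \<Rightarrow> complex^'n^'n \<Rightarrow> complex^'n^'n"  (infixl "\<circ>\<^sub>s" 70) where
  "A \<circ>\<^sub>s B = pos_sqrt A ** B ** pos_sqrt A"

(* Continuity refers to the library norm on complex^'n^'n (the Frobenius norm), which induces
   the same topology as the operator norm. *)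
definition cont_seq_endo :: "(complex^'n^'n \<Rightarrow> complex^'n^'n) \<Rightarrow> bool" where
  "cont_seq_endo \<phi> \<longleftrightarrow>
     \<phi> \<in> effects \<rightarrow> effects \<and> continuous_on effects \<phi> \<and>
     (\<forall>A\<in>effects. \<forall>B\<in>effects. \<phi> (A \<circ>\<^sub>s B) = \<phi> A \<circ>\<^sub>s \<phi> B)"

definition adj2 :: "complex^2^2 \<Rightarrow> complex^2^2" where
  "adj2 A = vector [vector [A$2$2, - A$1$2], vector [- A$2$1, A$1$1]]"

definition diag2 :: "real \<Rightarrow> real \<Rightarrow> complex^2^2" where
  "diag2 a b = vector [vector [of_real a, 0], vector [0, of_real b]]"

(* The determinant of an effect is real and lies in [0,1]. Unlike powr, the power used here
   satisfies 0^0 = 1. *)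
definition det_pow :: "complex^'n^'n \<Rightarrow> real \<Rightarrow> real" where
  "det_pow A c = (if c = 0 then 1 else Re (det A) powr c)"

(* There are continuous sequential endomorphisms not fixing the identity, such as the zero map. *)
lemma cont_seq_endo_zero: "cont_seq_endo (\<lambda>_. 0 :: complex^'n^'n)"
proof -
  have "pos_semidef (0 :: complex^'n^'n)"
    by (simp add: pos_semidef_def self_adjoint_def conj_transpose_def vec_eq_iff)
  moreover have sa1: "self_adjoint (mat 1 :: complex^'n^'n)"
    by (simp add: self_adjoint_def conj_transpose_def mat_def vec_eq_iff)
  moreover have "pos_semidef (mat 1 :: complex^'n^'n)"
    using sa1 by (auto simp: pos_semidef_def intro!: sum_nonneg)
  ultimately have "(0 :: complex^'n^'n) \<in> effects"
    by (simp add: effects_def loewner_le_def pos_semidef_def)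
  moreover have "(0 :: complex^'n^'n) \<circ>\<^sub>s 0 = 0"
    by (simp add: seq_prod_def matrix_matrix_mult_def vec_eq_iff)
  ultimately show ?thesis
    by (auto simp: cont_seq_endo_def)
qed

end

theory Submission
  imports Defs
begin

text \<open>
  A Hermitian matrix of size two is \<open>a + x \<cdot> \<sigma>\<close>, where \<open>a\<close> is real, \<open>x\<close> is a vector of
  \<open>\<real>\<^sup>3\<close> and \<open>\<sigma>\<close> are the Pauli matrices. In these Bloch coordinates positivity says
  \<open>\<bar>x\<bar> \<le> a\<close>, the determinant is \<open>a\<^sup>2 - \<bar>x\<bar>\<^sup>2\<close>, and the sequential product is an expression in inner
  products alone (\<open>seq_prod_herm\<close>). The whole argument therefore takes place in \<open>\<real> \<times> V\<close> for a
  Euclidean space \<open>V\<close>, and matrices come back only to name the maps that it finds.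

  Let \<open>\<phi>\<close> be unital. It sends invertible effects to invertible effects, because iterated square roots
  of an invertible effect tend to the identity and the determinant is multiplicative. So
  \<open>f(X) = log \<phi>(exp X)\<close> is defined on the closed cone of all \<open>X \<le> 0\<close>. Halving \<open>X\<close> is taking a square
  root, hence \<open>f(X/2) = f(X)/2\<close>. Trotter's formula, that \<open>log (exp(tX/2) exp(tY) exp(tX/2)) / t\<close> tends
  to \<open>X + Y\<close>, together with continuity of \<open>f\<close> then makes \<open>f\<close> additive (\<open>log_map_add\<close>), so it is
  the restriction of a linear map \<open>F\<close>.

  Differentiating the multiplicativity of \<open>\<phi>\<close> at \<open>exp X\<close> in a direction \<open>Y\<close> gives
  \<open>F (D X Y) = D (F X) (F Y)\<close>, where \<open>D X\<close> fixes the component of the vector part of \<open>Y\<close> along the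
  vector part \<open>v\<close> of \<open>X\<close> and multiplies the orthogonal component by \<open>\<bar>v\<bar> / sinh \<bar>v\<bar>\<close>. This factor
  is less than one unless \<open>v = 0\<close> and determines \<open>\<bar>v\<bar>\<close>, so the identity is very
  rigid (\<open>bch_deriv_intertwiner_form\<close>): on vector parts \<open>F\<close> is either zero or an isometry \<open>R\<close>, and in
  the second case \<open>F\<close> maps scalars to scalars. In the first case \<open>\<phi>\<close> depends on the determinant only;
  in the second \<open>\<phi>(a, x) = det\<^sup>c (a, R x)\<close> with \<open>c \<ge> 0\<close>. Both formulas extend from invertible
  effects to all effects by density.

  An isometry of \<open>\<real>\<^sup>3\<close> is a rotation or the negative of one, and rotations are the conjugations by
  unitary matrices (\<open>isometry_conj_by_unitary\<close>). Since \<open>(a, - x)\<close> is the adjugate of \<open>(a, x)\<close>, the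
  negatives of rotations produce the adjugate if \<open>c = 0\<close> and the inverse, multiplied by a power of the
  determinant, if \<open>c > 0\<close>.

  If \<open>\<phi>\<close> is not unital, \<open>\<phi>(1)\<close> is a projection \<open>P\<close> of rank zero or one, and \<open>\<phi>\<close> takes values in the
  multiples of \<open>P\<close>. The scalar factor is multiplicative; regarded as a unital endomorphism with
  scalar values it must be a power of the determinant.
\<close>

section \<open>The sequential product in Bloch coordinates\<close>

definition spin_disc :: "real \<times> 'a::real_inner \<Rightarrow> real" where
  "spin_disc p = (fst p)\<^sup>2 - snd p \<bullet> snd p"

definition spin_cone :: "(real \<times> 'a::real_inner) set" where
  "spin_cone = {p. norm (snd p) \<le> fst p}"

definition spin_effects :: "(real \<times> 'a::real_inner) set" where
  "spin_effects = {p. p \<in> spin_cone \<and> (1, 0) - p \<in> spin_cone}"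

text \<open>
  The formula is \<open>S B S\<close> with \<open>S\<close> the positive square root of the first factor: writing
  \<open>S = s + u \<cdot> \<sigma>\<close> and \<open>p = (a, x)\<close> with determinant \<open>d\<^sup>2\<close>, one has \<open>2 s\<^sup>2 = a + d\<close> and \<open>x = 2 s u\<close>. For
  \<open>p = 0\<close> the quotient is \<open>0 / 0 = 0\<close>, which is the right value. The formula makes sense in every real
  inner product space and is linear in the second factor.
\<close>

definition spin_prod :: "real \<times> 'a::real_inner \<Rightarrow> real \<times> 'a \<Rightarrow> real \<times> 'a" where
  "spin_prod p q =
     (fst p * fst q + snd p \<bullet> snd q,
      fst q *\<^sub>R snd p + sqrt (spin_disc p) *\<^sub>R snd q
        + (snd p \<bullet> snd q / (fst p + sqrt (spin_disc p))) *\<^sub>R snd p)"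

lemma spin_cone_iff: "p \<in> spin_cone \<longleftrightarrow> 0 \<le> fst p \<and> 0 \<le> spin_disc p"
proof -
  have "norm (snd p) \<le> fst p \<longleftrightarrow> 0 \<le> fst p \<and> (norm (snd p))\<^sup>2 \<le> (fst p)\<^sup>2"
    by (smt (verit) norm_ge_zero power2_le_imp_le power_mono)
  then show ?thesis by (simp add: spin_cone_def spin_disc_def power2_norm_eq_inner)
qed

lemma spin_cone_add: "p \<in> spin_cone \<Longrightarrow> q \<in> spin_cone \<Longrightarrow> p + q \<in> spin_cone"
  unfolding spin_cone_def by (auto intro: order_trans[OF norm_triangle_ineq])

lemma spin_disc_prod:
  assumes "p \<in> spin_cone"
  shows "spin_disc (spin_prod p q) = spin_disc p * spin_disc q"
proof (cases "fst p = 0")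
  case True
  with assms have "snd p = 0" by (simp add: spin_cone_def)
  with True show ?thesis by (simp add: spin_disc_def spin_prod_def)
next
  case False
  define a b d m X Y where "a = fst p" and "b = fst q" and "d = sqrt (spin_disc p)"
    and "m = snd p \<bullet> snd q" and "X = snd p \<bullet> snd p" and "Y = snd q \<bullet> snd q"
  have d0: "0 \<le> d" and a0: "0 < a"
    using assms False by (auto simp: d_def a_def spin_cone_iff)
  have dd: "d\<^sup>2 = a\<^sup>2 - X"
    using assms by (simp add: d_def a_def X_def spin_cone_iff) (simp add: spin_disc_def)
  define c where "c = m / (a + d)"
  have cm: "c * (a + d) = m" using a0 d0 by (simp add: c_def)
  have X: "X = (a - d) * (a + d)" using dd by (simp add: algebra_simps power2_eq_square)
  have cX: "c * X = m * (a - d)" unfolding X cm[symmetric] by simp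
  have ccX: "c\<^sup>2 * X = m * c * (a - d)" using cX by (simp add: power2_eq_square)
  have s: "snd p \<bullet> snd q = m" "snd q \<bullet> snd p = m" "snd p \<bullet> snd p = X" "snd q \<bullet> snd q = Y"
    by (simp_all add: m_def X_def Y_def inner_commute)
  have prod: "spin_prod p q = (a * b + m, (b + c) *\<^sub>R snd p + d *\<^sub>R snd q)"
    by (simp add: spin_prod_def a_def b_def d_def c_def m_def algebra_simps)
  have "spin_disc (spin_prod p q)
      = (a * b + m)\<^sup>2 - ((b + c)\<^sup>2 * X + d\<^sup>2 * Y + 2 * d * (b + c) * m)"
    unfolding prod spin_disc_def[of "(_, _)"]
    by (simp add: inner_add_left inner_add_right s) (simp add: algebra_simps power2_eq_square)
  also have "(b + c)\<^sup>2 * X = b\<^sup>2 * X + 2 * b * (c * X) + c\<^sup>2 * X"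
    by (simp add: power2_eq_square algebra_simps)
  also have "\<dots> = b\<^sup>2 * X + 2 * b * (m * (a - d)) + m * c * (a - d)" by (simp only: cX ccX)
  also have "(a * b + m)\<^sup>2 - (b\<^sup>2 * X + 2 * b * (m * (a - d)) + m * c * (a - d) + d\<^sup>2 * Y + 2 * d * (b + c) * m)
      = a\<^sup>2 * b\<^sup>2 - b\<^sup>2 * X - d\<^sup>2 * Y + m * (m - c * (a + d))"
    by (simp add: power2_eq_square algebra_simps)
  also have "\<dots> = (a\<^sup>2 - X) * (b\<^sup>2 - Y)" unfolding cm dd[symmetric] by (simp add: dd algebra_simps)
  also have "\<dots> = spin_disc p * spin_disc q" by (simp add: spin_disc_def a_def b_def X_def Y_def)
  finally show ?thesis .
qed

lemma spin_prod_mem_cone: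
  assumes "p \<in> spin_cone" "q \<in> spin_cone"
  shows "spin_prod p q \<in> spin_cone"
proof -
  have "- (snd p \<bullet> snd q) \<le> norm (snd p) * norm (snd q)"
    using Cauchy_Schwarz_ineq2[of "snd p" "snd q"] by simp
  also have "\<dots> \<le> fst p * fst q"
    using assms by (intro mult_mono) (auto simp: spin_cone_def intro: order_trans[OF norm_ge_zero])
  finally have "0 \<le> fst (spin_prod p q)" by (simp add: spin_prod_def)
  moreover have "0 \<le> spin_disc (spin_prod p q)"
    using assms by (simp add: spin_disc_prod spin_cone_iff)
  ultimately show ?thesis by (simp add: spin_cone_iff)
qed

lemma spin_prod_one [simp]: "spin_prod p (1, 0) = p"
  by (simp add: spin_prod_def)

lemma spin_prod_one_left [simp]: "spin_prod (1, 0) p = p"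
  by (simp add: spin_prod_def spin_disc_def prod_eq_iff)

lemma spin_prod_diff: "spin_prod p (q - r) = spin_prod p q - spin_prod p r"
  by (simp add: spin_prod_def algebra_simps diff_divide_distrib prod_eq_iff)

text \<open>
  The product is below its first factor, because the difference is the product of that factor with the
  complementary effect of the second.
\<close>

lemma spin_prod_mem_effects:
  assumes "p \<in> spin_effects" "q \<in> spin_effects"
  shows "spin_prod p q \<in> spin_effects"
proof -
  have "spin_prod p ((1, 0) - q) \<in> spin_cone" "(1, 0) - p \<in> spin_cone" "spin_prod p q \<in> spin_cone"
    using assms by (auto simp: spin_effects_def intro!: spin_prod_mem_cone)
  from spin_cone_add[OF this(1,2)] this(3) show ?thesis
    by (simp add: spin_effects_def spin_prod_diff)
qed

lemma spin_effects_iff: "(a, x) \<in> spin_effects \<longleftrightarrow> norm x \<le> a \<and> a + norm x \<le> 1"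
  by (auto simp: spin_effects_def spin_cone_def)

section \<open>Exponential, logarithm and their composition law\<close>

text \<open>
  The value at zero is the limit, so that the functions are continuous and the vector-valued
  functions \<open>vsinh\<close> and \<open>varsinh\<close> need no exception at the origin.
\<close>

definition sinhc :: "real \<Rightarrow> real" where
  "sinhc r = (if r = 0 then 1 else sinh r / r)"

definition arsinhc :: "real \<Rightarrow> real" where
  "arsinhc r = (if r = 0 then 1 else arsinh r / r)"

definition vsinh :: "'a::real_inner \<Rightarrow> 'a" where
  "vsinh v = sinhc (norm v) *\<^sub>R v"

definition varsinh :: "'a::real_inner \<Rightarrow> 'a" where
  "varsinh u = arsinhc (norm u) *\<^sub>R u"

text \<open>
  In Bloch coordinates \<open>exp (h + v \<cdot> \<sigma>) = e\<^sup>h (cosh \<bar>v\<bar> + sinh \<bar>v\<bar> (v / \<bar>v\<bar>) \<cdot> \<sigma>)\<close>. The inverse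
  divides by the square root of the determinant and applies \<open>arsinh\<close>; compared with
  \<open>artanh\<close> of the ratio of the two coordinates, this makes the vector part of the logarithm a function
  of the single vector \<open>x / d\<close>.
\<close>

definition spin_exp :: "real \<times> 'a::real_inner \<Rightarrow> real \<times> 'a" where
  "spin_exp p = exp (fst p) *\<^sub>R (cosh (norm (snd p)), vsinh (snd p))"

definition spin_log :: "real \<times> 'a::real_inner \<Rightarrow> real \<times> 'a" where
  "spin_log p = (ln (sqrt (spin_disc p)), varsinh (snd p /\<^sub>R sqrt (spin_disc p)))"

text \<open>
  The vector part of \<open>log (exp(v/2) exp(w) exp(v/2))\<close>, a symmetric version of the
  Baker--Campbell--Hausdorff series in closed form.
\<close>

definition bch :: "'a::real_inner \<Rightarrow> 'a \<Rightarrow> 'a" where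
  "bch v w = varsinh (cosh (norm w) *\<^sub>R vsinh v + vsinh w
      + (vsinh v \<bullet> vsinh w / (cosh (norm v) + 1)) *\<^sub>R vsinh v)"

lemma sinhc_pos: "0 < sinhc r"
  by (cases "r > 0") (auto simp: sinhc_def zero_less_divide_iff)

lemma norm_vsinh [simp]: "norm (vsinh v) = sinh (norm v)"
  by (simp add: vsinh_def sinhc_def)

lemma norm_varsinh [simp]: "norm (varsinh v) = arsinh (norm v)"
  by (simp add: varsinh_def arsinhc_def abs_if divide_less_0_iff not_less)

lemma varsinh_vsinh [simp]: "varsinh (vsinh v) = v"
  unfolding varsinh_def norm_vsinh by (simp add: vsinh_def arsinhc_def sinhc_def arsinh_sinh_real)

lemma vsinh_varsinh [simp]: "vsinh (varsinh v) = v"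
  unfolding vsinh_def norm_varsinh by (simp add: varsinh_def arsinhc_def sinhc_def)

lemma vsinh_0 [simp]: "vsinh 0 = 0" and varsinh_0 [simp]: "varsinh 0 = 0"
  by (simp_all add: vsinh_def varsinh_def)

lemma continuous_at_arsinhc: "isCont arsinhc r"
proof (cases "r = 0")
  case True
  have "(arsinh has_field_derivative 1) (at (0::real))"
    using arsinh_real_has_field_derivative[of 0 UNIV] by simp
  then have "((\<lambda>h::real. arsinh h / h) \<longlongrightarrow> 1) (at 0)"
    by (simp add: has_field_derivative_iff)
  then have "(arsinhc \<longlongrightarrow> 1) (at 0)"
    by (rule Lim_transform_eventually) (auto simp: arsinhc_def eventually_at intro!: exI[of _ 1])
  then show ?thesis using True by (simp add: isCont_def arsinhc_def)
next
  case False
  have "isCont (\<lambda>r. arsinh r / r) r" using False by (intro continuous_intros) auto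
  moreover have "eventually (\<lambda>s. arsinh s / s = arsinhc s) (nhds r)"
    using t1_space_nhds[OF False] by eventually_elim (auto simp: arsinhc_def)
  ultimately show ?thesis using isCont_cong by force
qed

lemma continuous_at_sinhc: "isCont sinhc r"
proof (cases "r = 0")
  case True
  have "(sinh has_field_derivative 1) (at (0::real))"
    by (auto intro!: derivative_eq_intros)
  then have "((\<lambda>h::real. sinh h / h) \<longlongrightarrow> 1) (at 0)"
    by (simp add: has_field_derivative_iff)
  then have "(sinhc \<longlongrightarrow> 1) (at 0)"
    by (rule Lim_transform_eventually) (auto simp: sinhc_def eventually_at intro!: exI[of _ 1])
  then show ?thesis using True by (simp add: isCont_def sinhc_def)
next
  case False
  have "isCont (\<lambda>r. sinh r / r) r" using False by (intro continuous_intros) auto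
  moreover have "eventually (\<lambda>s. sinh s / s = sinhc s) (nhds r)"
    using t1_space_nhds[OF False] by eventually_elim (auto simp: sinhc_def)
  ultimately show ?thesis using isCont_cong by force
qed

lemma tendsto_arsinhc: "(f \<longlongrightarrow> r) F \<Longrightarrow> ((\<lambda>x. arsinhc (f x)) \<longlongrightarrow> arsinhc r) F"
  by (rule isCont_tendsto_compose[OF continuous_at_arsinhc])

lemma tendsto_sinhc: "(f \<longlongrightarrow> r) F \<Longrightarrow> ((\<lambda>x. sinhc (f x)) \<longlongrightarrow> sinhc r) F"
  by (rule isCont_tendsto_compose[OF continuous_at_sinhc])

lemma tendsto_vsinh: "(f \<longlongrightarrow> v) F \<Longrightarrow> ((\<lambda>x. vsinh (f x)) \<longlongrightarrow> vsinh v) F"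
  unfolding vsinh_def by (intro tendsto_intros tendsto_sinhc)

lemma tendsto_varsinh: "(f \<longlongrightarrow> v) F \<Longrightarrow> ((\<lambda>x. varsinh (f x)) \<longlongrightarrow> varsinh v) F"
  unfolding varsinh_def by (intro tendsto_intros tendsto_arsinhc)

lemma tendsto_spin_exp: "(f \<longlongrightarrow> p) F \<Longrightarrow> ((\<lambda>x. spin_exp (f x)) \<longlongrightarrow> spin_exp p) F"
  unfolding spin_exp_def by (intro tendsto_intros tendsto_vsinh)

lemma tendsto_spin_disc: "(f \<longlongrightarrow> p) F \<Longrightarrow> ((\<lambda>x. spin_disc (f x)) \<longlongrightarrow> spin_disc p) F"
  unfolding spin_disc_def by (intro tendsto_intros)

lemma tendsto_spin_log:
  "(f \<longlongrightarrow> p) F \<Longrightarrow> 0 < spin_disc p \<Longrightarrow> ((\<lambda>x. spin_log (f x)) \<longlongrightarrow> spin_log p) F"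
  unfolding spin_log_def by (intro tendsto_intros tendsto_varsinh tendsto_spin_disc) auto

lemma spin_disc_exp [simp]: "spin_disc (spin_exp p) = (exp (fst p))\<^sup>2"
proof -
  have "vsinh (snd p) \<bullet> vsinh (snd p) = (sinh (norm (snd p)))\<^sup>2"
    by (simp flip: power2_norm_eq_inner)
  then show ?thesis
    by (simp add: spin_disc_def spin_exp_def power_mult_distrib cosh_square_eq algebra_simps
        flip: power2_eq_square)
qed

lemma spin_log_exp [simp]: "spin_log (spin_exp p) = p"
  by (simp add: spin_log_def) (simp add: spin_exp_def)

lemma fst_pos_if_disc_pos:
  assumes "p \<in> spin_cone" "0 < spin_disc p"
  shows "0 < fst p"
  using assms inner_ge_zero[of "snd p"]
  by (cases "fst p = 0") (auto simp: spin_cone_iff spin_disc_def)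

lemma spin_exp_log:
  assumes "p \<in> spin_cone" "0 < spin_disc p"
  shows "spin_exp (spin_log p) = p"
proof -
  define d where "d = sqrt (spin_disc p)"
  have d: "0 < d" "d\<^sup>2 = (fst p)\<^sup>2 - (norm (snd p))\<^sup>2"
    using assms(2) by (auto simp: d_def) (simp add: spin_disc_def power2_norm_eq_inner)
  have "cosh (norm (varsinh (snd p /\<^sub>R d))) = sqrt ((norm (snd p) / d)\<^sup>2 + 1)"
    using d by (simp add: cosh_arsinh_real field_simps)
  also have "(norm (snd p) / d)\<^sup>2 + 1 = (fst p / d)\<^sup>2"
    using d by (simp add: field_simps)
  finally have "cosh (norm (varsinh (snd p /\<^sub>R d))) = fst p / d"
    using d(1) fst_pos_if_disc_pos[OF assms] by simp
  then show ?thesis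
    unfolding spin_exp_def spin_log_def d_def[symmetric] using d(1)
    by (simp add: prod_eq_iff del: norm_varsinh)
qed

lemma spin_exp_mem_cone: "spin_exp p \<in> spin_cone"
  by (simp add: spin_cone_iff) (simp add: spin_exp_def)

lemma spin_exp_mem_effects_iff:
  "spin_exp p \<in> spin_effects \<longleftrightarrow> fst p + norm (snd p) \<le> 0"
proof -
  have "spin_exp p \<in> spin_effects \<longleftrightarrow> fst (spin_exp p) + norm (snd (spin_exp p)) \<le> 1"
    using spin_exp_mem_cone[of p]
    by (cases "spin_exp p") (simp add: spin_effects_iff, simp add: spin_cone_def)
  also have "fst (spin_exp p) + norm (snd (spin_exp p)) = exp (fst p + norm (snd p))"
    by (simp add: spin_exp_def exp_add cosh_plus_sinh flip: distrib_left)
  finally show ?thesis by simp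
qed

lemma spin_exp_0 [simp]: "spin_exp 0 = (1, 0)"
  by (simp add: spin_exp_def zero_prod_def)

text \<open>
  The scalar parts of the logarithms add up because the determinant is multiplicative, and the vector
  parts compose independently of them because scalar factors cancel in \<open>x / d\<close>.
\<close>

lemma spin_prod_exp:
  "spin_prod (spin_exp p) (spin_exp q) = spin_exp (fst p + fst q, bch (snd p) (snd q))"
proof -
  let ?P = "spin_prod (spin_exp p) (spin_exp q)"
  define u v c where "u = vsinh (snd p)" and "v = vsinh (snd q)" and "c = cosh (norm (snd p))"
  have disc: "spin_disc ?P = (exp (fst p + fst q))\<^sup>2"
    by (simp add: spin_disc_prod spin_exp_mem_cone exp_add power_mult_distrib)
  have "?P \<in> spin_cone" by (intro spin_prod_mem_cone spin_exp_mem_cone)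
  then have P: "?P = spin_exp (spin_log ?P)" using disc by (simp add: spin_exp_log)
  have c: "exp (fst p) * c + exp (fst p) = exp (fst p) * (c + 1)" "c + 1 > 0"
    by (auto simp: algebra_simps c_def add_pos_pos)
  have snd: "snd ?P = exp (fst p + fst q) *\<^sub>R
     (cosh (norm (snd q)) *\<^sub>R u + v + (u \<bullet> v / (c + 1)) *\<^sub>R u)"
    unfolding spin_prod_def spin_disc_exp
    by (simp add: spin_exp_def c flip: u_def v_def c_def)
       (simp add: algebra_simps exp_add)
  have "spin_log ?P = (fst p + fst q, bch (snd p) (snd q))"
    unfolding spin_log_def disc bch_def snd by (simp add: u_def v_def c_def)
  with P show ?thesis by simp
qed

section \<open>First-order behaviour of the composition law\<close>

lemma cosh_norm_scaleR: "cosh (norm (t *\<^sub>R v)) = cosh (t * norm v)"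
  by (simp add: abs_mult flip: cosh_real_abs[of "t * norm v"])

lemma vsinh_scaleR: "v \<noteq> 0 \<Longrightarrow> vsinh (t *\<^sub>R v) = (sinh (t * norm v) / norm v) *\<^sub>R v"
  by (auto simp: vsinh_def sinhc_def abs_if)

lemma tendsto_vsinh_scaleR_divide:
  "((\<lambda>t. vsinh (t *\<^sub>R v) /\<^sub>R t) \<longlongrightarrow> v) (at_right 0)"
proof -
  have "((\<lambda>t. sinhc (norm (t *\<^sub>R v)) *\<^sub>R v) \<longlongrightarrow> sinhc (norm (0 *\<^sub>R v)) *\<^sub>R v) (at_right 0)"
    by (intro tendsto_intros tendsto_sinhc)
  then have "((\<lambda>t. sinhc (norm (t *\<^sub>R v)) *\<^sub>R v) \<longlongrightarrow> v) (at_right 0)"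
    by (simp add: sinhc_def)
  then show ?thesis
    by (rule Lim_transform_eventually)
       (auto simp: vsinh_def eventually_at intro!: exI[of _ 1])
qed

text \<open>
  Near the origin \<open>vsinh\<close> and \<open>varsinh\<close> are the identity to first order, and the correction term in
  \<open>bch\<close> is of higher order.
\<close>

lemma bch_trotter:
  "((\<lambda>t. bch (t *\<^sub>R v) (t *\<^sub>R w) /\<^sub>R t) \<longlongrightarrow> v + w) (at_right 0)"
proof -
  define u where "u t = cosh (norm (t *\<^sub>R w)) *\<^sub>R vsinh (t *\<^sub>R v) + vsinh (t *\<^sub>R w)
      + (vsinh (t *\<^sub>R v) \<bullet> vsinh (t *\<^sub>R w) / (cosh (norm (t *\<^sub>R v)) + 1)) *\<^sub>R vsinh (t *\<^sub>R v)" for t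
  have s: "((\<lambda>t. vsinh (t *\<^sub>R x)) \<longlongrightarrow> 0) (at_right 0)" for x :: 'a
  proof -
    have "((\<lambda>t. vsinh (t *\<^sub>R x)) \<longlongrightarrow> vsinh (0 *\<^sub>R x)) (at_right 0)"
      by (intro tendsto_vsinh tendsto_intros)
    then show ?thesis by simp
  qed
  have c: "((\<lambda>t. cosh (norm (t *\<^sub>R x))) \<longlongrightarrow> 1) (at_right 0)" for x :: 'a
    by (auto intro!: tendsto_eq_intros)
  have "((\<lambda>t. cosh (norm (t *\<^sub>R w)) *\<^sub>R (vsinh (t *\<^sub>R v) /\<^sub>R t) + vsinh (t *\<^sub>R w) /\<^sub>R t
      + (vsinh (t *\<^sub>R v) \<bullet> vsinh (t *\<^sub>R w) / (cosh (norm (t *\<^sub>R v)) + 1)) *\<^sub>R (vsinh (t *\<^sub>R v) /\<^sub>R t))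
      \<longlongrightarrow> 1 *\<^sub>R v + w + ((0 :: 'a) \<bullet> (0 :: 'a) / (1 + 1)) *\<^sub>R v) (at_right 0)"
    by (intro tendsto_intros tendsto_vsinh_scaleR_divide s c) auto
  then have u: "((\<lambda>t. u t /\<^sub>R t) \<longlongrightarrow> v + w) (at_right 0)"
    by (simp add: u_def scaleR_add_right mult.commute)
  have "(u \<longlongrightarrow> 1 *\<^sub>R 0 + 0 + ((0 :: 'a) \<bullet> (0 :: 'a) / (1 + 1)) *\<^sub>R 0) (at_right 0)"
    unfolding u_def by (intro tendsto_intros s c) auto
  then have "((\<lambda>t. arsinhc (norm (u t))) \<longlongrightarrow> arsinhc (norm (0::'a))) (at_right 0)"
    by (intro tendsto_arsinhc tendsto_norm) simp
  moreover have "bch (t *\<^sub>R v) (t *\<^sub>R w) = arsinhc (norm (u t)) *\<^sub>R u t" for t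
    by (simp only: bch_def u_def varsinh_def)
  ultimately show ?thesis
    using tendsto_scaleR[OF _ u] by (fastforce simp: arsinhc_def[of 0] mult.commute)
qed

text \<open>
  The derivative of \<open>bch v\<close> at zero: the identity along \<open>v\<close> and multiplication by \<open>\<bar>v\<bar> / sinh \<bar>v\<bar>\<close>
  on the orthogonal complement of \<open>v\<close>. For \<open>v = 0\<close> the division by zero is harmless, as its
  coefficient vanishes.
\<close>

definition bch_deriv :: "'a::real_inner \<Rightarrow> 'a \<Rightarrow> 'a" where
  "bch_deriv v w = (1 / sinhc (norm v)) *\<^sub>R w
     + ((1 - 1 / sinhc (norm v)) * (v \<bullet> w / (v \<bullet> v))) *\<^sub>R v"

lemma bch_0_left [simp]: "bch 0 w = w" and bch_0_right [simp]: "bch v 0 = v"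
  by (simp_all add: bch_def)

text \<open>
  Along the ray in direction \<open>w\<close> everything stays in the plane spanned by \<open>u = vsinh v\<close> and \<open>w\<close>, so
  \<open>bch v (t w)\<close> is a combination of these two fixed vectors with real coefficients \<open>g A\<close> and \<open>g B\<close>, which
  are differentiated as functions of one variable.
\<close>

lemma bch_derivative_at_0:
  "((\<lambda>t. (bch v (t *\<^sub>R w) - v) /\<^sub>R t) \<longlongrightarrow> bch_deriv v w) (at_right 0)"
proof (cases "v = 0 \<or> w = 0")
  case True
  then have "bch_deriv v w = w" by (auto simp: bch_deriv_def sinhc_def)
  have "((\<lambda>t. w) \<longlongrightarrow> w) (at_right (0::real))" by simp
  then have "((\<lambda>t. (bch v (t *\<^sub>R w) - v) /\<^sub>R t) \<longlongrightarrow> w) (at_right 0)"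
    by (rule Lim_transform_eventually)
       (use True in \<open>auto simp: eventually_at intro!: exI[of _ 1]\<close>)
  then show ?thesis using \<open>bch_deriv v w = w\<close> by simp
next
  case False
  define u where "u = vsinh v"
  define r S C m where "r = norm v" and "S = sinh r" and "C = cosh r" and "m = u \<bullet> w"
  have r: "0 < r" "0 < S" "0 < C" using False by (auto simp: r_def S_def C_def)
  have CS: "S\<^sup>2 = C\<^sup>2 - 1" by (simp add: S_def C_def cosh_square_eq)
  have uu: "u \<bullet> u = S\<^sup>2" "norm u = S"
    by (simp_all add: u_def S_def r_def flip: power2_norm_eq_inner)
  have vu: "v = (r / S) *\<^sub>R u"
    using r by (simp add: u_def vsinh_def sinhc_def S_def r_def)
  define A B n g where "A t = cosh (t * norm w) + m / (C + 1) * (sinh (t * norm w) / norm w)"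
    and "B t = sinh (t * norm w) / norm w"
    and "n t = sqrt ((A t)\<^sup>2 * S\<^sup>2 + 2 * (A t * B t * m) + (B t)\<^sup>2 * (w \<bullet> w))"
    and "g t = arsinh (n t) / n t" for t
  have bch: "bch v (t *\<^sub>R w) = arsinhc (n t) *\<^sub>R (A t *\<^sub>R u + B t *\<^sub>R w)" for t
  proof -
    have "bch v (t *\<^sub>R w) = varsinh (A t *\<^sub>R u + B t *\<^sub>R w)"
    proof -
      have "vsinh (t *\<^sub>R w) = B t *\<^sub>R w" using False by (simp add: B_def vsinh_scaleR)
      moreover have "A t = cosh (t * norm w) + B t * m / (C + 1)"
        by (simp add: A_def B_def mult.commute)
      ultimately show ?thesis
        unfolding bch_def u_def[symmetric] cosh_norm_scaleR r_def[symmetric] C_def[symmetric]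
        by (simp add: m_def scaleR_add_left add_ac)
    qed
    moreover have "norm (A t *\<^sub>R u + B t *\<^sub>R w) = n t"
      by (simp add: n_def norm_eq_sqrt_inner inner_add_left inner_add_right uu m_def
          inner_commute[of w u] power2_eq_square algebra_simps)
    ultimately show ?thesis by (simp add: varsinh_def)
  qed
  have 0: "A 0 = 1" "B 0 = 0" "n 0 = S" using r by (simp_all add: A_def B_def n_def)
  have C1: "C + 1 \<noteq> 0" using r by simp
  have dA: "(A has_field_derivative m / (C + 1)) (at 0)"
    unfolding A_def using False C1 by (auto intro!: derivative_eq_intros)
  have dB: "(B has_field_derivative 1) (at 0)"
    unfolding B_def using False by (auto intro!: derivative_eq_intros)
  have dn: "(n has_field_derivative (m / (C + 1) * S\<^sup>2 + m) / S) (at 0)"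
  proof -
    define q where "q t = (A t)\<^sup>2 * S\<^sup>2 + 2 * (A t * B t * m) + (B t)\<^sup>2 * (w \<bullet> w)" for t
    have "(q has_field_derivative 2 * (m / (C + 1) * S\<^sup>2 + m)) (at 0)"
      unfolding q_def by (auto intro!: derivative_eq_intros dA dB simp: 0)
    moreover have q0: "q 0 = S\<^sup>2" by (simp add: q_def 0)
    ultimately have "((\<lambda>t. sqrt (q t)) has_field_derivative
        inverse (sqrt (q 0)) / 2 * (2 * (m / (C + 1) * S\<^sup>2 + m))) (at 0)"
      using r by (intro DERIV_chain2[OF DERIV_real_sqrt]) simp_all
    moreover have "inverse (sqrt (q 0)) / 2 * (2 * (m / (C + 1) * S\<^sup>2 + m))
        = (m / (C + 1) * S\<^sup>2 + m) / S"
    proof -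
      have "inverse S / 2 * (2 * M) = M / S" for M by (simp add: field_simps)
      moreover have "sqrt (q 0) = S" using r by (simp only: q0) simp
      ultimately show ?thesis by (simp only:)
    qed
    moreover have "n = (\<lambda>t. sqrt (q t))" by (simp add: fun_eq_iff n_def q_def)
    ultimately show ?thesis by (simp only:)
  qed
  have S2: "S\<^sup>2 = (C - 1) * (C + 1)" unfolding CS by (simp add: power2_eq_square algebra_simps)
  then have "m / (C + 1) * S\<^sup>2 = m * (C - 1)" using C1 by simp
  then have "m / (C + 1) * S\<^sup>2 + m = m * C" by (simp only: right_diff_distrib)
  with dn have dn: "(n has_field_derivative m * C / S) (at 0)" by simp
  have sq: "sqrt (S\<^sup>2 + 1) = C" using r by (simp add: CS)
  have ar: "arsinh S = r" by (simp add: S_def arsinh_sinh_real)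
  have dg: "(g has_field_derivative (m * C / S) * (1 / (S * C) - r / S\<^sup>2)) (at 0)"
  proof -
    have "((\<lambda>t. arsinh (n t)) has_field_derivative (1 / sqrt ((n 0)\<^sup>2 + 1)) * (m * C / S)) (at 0)"
      by (intro DERIV_chain2[OF arsinh_real_has_field_derivative dn])
    then have "((\<lambda>t. arsinh (n t)) has_field_derivative (1 / C) * (m * C / S)) (at 0)"
      by (simp only: 0 sq)
    from DERIV_divide[OF this dn] show ?thesis
      unfolding g_def
      by (rule DERIV_cong) (use r in \<open>simp_all add: 0 ar field_simps power2_eq_square\<close>)
  qed
  define k where "k = m / S\<^sup>2 - r * m / S^3"
  have "((\<lambda>t. g t * A t) has_field_derivative
      (m * C / S) * (1 / (S * C) - r / S\<^sup>2) + r / S * (m / (C + 1))) (at 0)"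
    by (auto intro!: derivative_eq_intros dg dA simp: 0) (simp add: g_def 0 ar)
  moreover have "(m * C / S) * (1 / (S * C) - r / S\<^sup>2) + r / S * (m / (C + 1)) = k"
  proof -
    \<comment> \<open>a common denominator, from \<open>S\<^sup>2 = (C - 1) (C + 1)\<close>\<close>
    have "r / S * (m / (C + 1)) = r * m * (C - 1) / S^3"
    proof -
      have "S^3 = S * ((C - 1) * (C + 1))"
        using S2 by (simp add: power3_eq_cube power2_eq_square)
      moreover have "C - 1 \<noteq> 0" using CS r by auto
      ultimately show ?thesis using r by simp
    qed
    moreover have "(m * C / S) * (1 / (S * C) - r / S\<^sup>2) = m / S\<^sup>2 - r * m * C / S^3"
      using r by (simp add: field_simps power2_eq_square power3_eq_cube)
    moreover have "r * m * (C - 1) / S^3 = r * m * C / S^3 - r * m / S^3"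
      by (simp add: right_diff_distrib diff_divide_distrib)
    ultimately show ?thesis by (simp only: k_def)
  qed
  ultimately have dgA: "((\<lambda>t. g t * A t) has_field_derivative k) (at 0)" by simp
  have dgB: "((\<lambda>t. g t * B t) has_field_derivative r / S) (at 0)"
    by (auto intro!: derivative_eq_intros dg dB simp: 0) (simp add: g_def 0 ar)
  have g0: "g 0 = r / S" by (simp add: g_def 0 ar)
  have right: "((\<lambda>t. (f t - f 0) / t) \<longlongrightarrow> D) (at_right 0)"
    if "(f has_field_derivative D) (at 0)" for f :: "real \<Rightarrow> real" and D
    using that by (auto simp: has_field_derivative_iff intro: filterlim_mono at_le)
  have lim: "((\<lambda>t. ((g t * A t - r / S) / t) *\<^sub>R u + (g t * B t / t) *\<^sub>R w)
      \<longlongrightarrow> k *\<^sub>R u + (r / S) *\<^sub>R w) (at_right 0)"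
    using tendsto_add[OF tendsto_scaleR[OF right[OF dgA] tendsto_const[of u]]
        tendsto_scaleR[OF right[OF dgB] tendsto_const[of w]]]
    by (simp add: 0 g0)
  have "isCont n 0" using dn by (rule DERIV_isCont)
  then have "(n \<longlongrightarrow> S) (at_right 0)"
    by (auto simp: isCont_def 0 intro: filterlim_mono at_le)
  then have "eventually (\<lambda>t. 0 < n t) (at_right 0)"
    using r(2) by (rule order_tendstoD)
  then have ev: "eventually (\<lambda>t. ((g t * A t - r / S) / t) *\<^sub>R u + (g t * B t / t) *\<^sub>R w
      = (bch v (t *\<^sub>R w) - v) /\<^sub>R t) (at_right 0)"
  proof eventually_elim
    case (elim t)
    then have "arsinhc (n t) = g t" by (simp add: arsinhc_def g_def)
    then show ?case
      by (subst vu) (simp add: bch algebra_simps divide_inverse)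
  qed
  have "k *\<^sub>R u + (r / S) *\<^sub>R w = bch_deriv v w"
  proof -
    have "sinhc (norm v) = S / r" using r by (simp add: sinhc_def S_def r_def)
    moreover have "v \<bullet> w / (v \<bullet> v) = m * r / S / r\<^sup>2"
      by (simp add: power2_norm_eq_inner[symmetric] r_def[symmetric])
         (subst vu, simp add: m_def)
    ultimately have "bch_deriv v w = (r / S) *\<^sub>R w + ((1 - r / S) * (m * r / S / r\<^sup>2)) *\<^sub>R (r / S) *\<^sub>R u"
      unfolding bch_deriv_def using vu by simp
    also have "((1 - r / S) * (m * r / S / r\<^sup>2)) *\<^sub>R (r / S) *\<^sub>R u = k *\<^sub>R u"
      using r by (simp add: k_def field_simps power2_eq_square power3_eq_cube)
    finally show ?thesis by simp
  qed
  with Lim_transform_eventually[OF lim ev] show ?thesis by simp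
qed

section \<open>Linear maps commuting with the derivative of the composition law\<close>

lemma sinh_less_mult_cosh: "0 < r \<Longrightarrow> sinh r < r * cosh (r::real)"
proof -
  assume "0 < r"
  have "(\<lambda>r. r * cosh r - sinh r) 0 < (\<lambda>r. r * cosh r - sinh r) r"
  proof (rule DERIV_pos_imp_increasing_open[OF \<open>0 < r\<close>])
    fix x :: real assume "0 < x" "x < r"
    then show "\<exists>y. ((\<lambda>r. r * cosh r - sinh r) has_real_derivative y) (at x) \<and> 0 < y"
      by (intro exI[of _ "x * sinh x"]) (auto intro!: derivative_eq_intros)
  qed (auto intro!: continuous_intros)
  then show ?thesis by simp
qed

text \<open>
  The rigidity of the intertwining relation below rests on this: the contraction factor of
  \<open>bch_deriv v\<close> determines \<open>\<bar>v\<bar>\<close>.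
\<close>

lemma sinhc_strict_mono:
  assumes "0 \<le> r" "r < s"
  shows "sinhc r < sinhc s"
proof (rule DERIV_pos_imp_increasing_open[OF \<open>r < s\<close>])
  fix x assume x: "r < x" "x < s"
  then have "0 < x" using assms by simp
  define D where "D = (cosh x * x - sinh x * 1) / (x * x)"
  have "(sinh has_real_derivative cosh x) (at x)" by (auto intro!: derivative_eq_intros)
  from DERIV_divide[OF this DERIV_ident] have d: "((\<lambda>r. sinh r / r) has_real_derivative D) (at x)"
    using \<open>0 < x\<close> unfolding D_def by blast
  have "eventually (\<lambda>s. sinh s / s = sinhc s) (nhds x)"
    using t1_space_nhds[of x 0] \<open>0 < x\<close> by (auto elim!: eventually_mono simp: sinhc_def)
  from iffD1[OF DERIV_cong_ev[OF refl this refl] d]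
  have "(sinhc has_real_derivative D) (at x)" .
  moreover have "0 < D"
    unfolding D_def using sinh_less_mult_cosh[OF \<open>0 < x\<close>] \<open>0 < x\<close>
    by (intro divide_pos_pos mult_pos_pos) (simp_all add: mult.commute)
  ultimately show "\<exists>y. (sinhc has_real_derivative y) (at x) \<and> 0 < y" by blast
next
  show "continuous_on {r..s} sinhc"
    using continuous_at_sinhc continuous_at_imp_continuous_on by blast
qed

lemma sinhc_inject: "0 \<le> r \<Longrightarrow> 0 \<le> s \<Longrightarrow> sinhc r = sinhc s \<Longrightarrow> r = s"
  using sinhc_strict_mono[of r s] sinhc_strict_mono[of s r] by linarith

lemma sinhc_0 [simp]: "sinhc 0 = 1"
  by (simp add: sinhc_def)

lemma sinhc_eq_1_iff: "0 \<le> r \<Longrightarrow> sinhc r = 1 \<longleftrightarrow> r = 0"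
  using sinhc_inject[of r 0] by auto

lemma bch_deriv_0_right [simp]: "bch_deriv v 0 = 0"
  and bch_deriv_0_left [simp]: "bch_deriv 0 w = w"
  by (simp_all add: bch_deriv_def sinhc_def)

lemma bch_deriv_orthogonal: "v \<bullet> w = 0 \<Longrightarrow> bch_deriv v w = (1 / sinhc (norm v)) *\<^sub>R w"
  by (simp add: bch_deriv_def)

lemma inner_bch_deriv: "v \<bullet> bch_deriv v w = v \<bullet> w"
proof (cases "v = 0")
  case False
  then have "c * (v \<bullet> w / (v \<bullet> v)) * (v \<bullet> v) = c * (v \<bullet> w)" for c by simp
  then show ?thesis
    unfolding bch_deriv_def inner_add_right inner_scaleR_right by (simp only: left_diff_distrib)
qed simp

lemma bch_deriv_parallel: "bch_deriv (a *\<^sub>R v) (b *\<^sub>R v) = b *\<^sub>R v"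
proof (cases "a *\<^sub>R v = 0")
  case False
  then have "v \<bullet> v \<noteq> 0" "a \<noteq> 0" by auto
  then have "((a *\<^sub>R v) \<bullet> (b *\<^sub>R v) / ((a *\<^sub>R v) \<bullet> (a *\<^sub>R v))) * a = b" by simp
  then have c: "(c * ((a *\<^sub>R v) \<bullet> (b *\<^sub>R v) / ((a *\<^sub>R v) \<bullet> (a *\<^sub>R v)))) *\<^sub>R (a *\<^sub>R v) = (c * b) *\<^sub>R v" for c
    by (simp only: scaleR_scaleR mult.assoc)
  show ?thesis unfolding bch_deriv_def c scaleR_scaleR
    by (simp only: scaleR_add_left[symmetric]) (simp add: algebra_simps)
qed auto

text \<open>
  The part of \<open>w\<close> orthogonal to \<open>v\<close> is contracted by a factor other than one, so it must vanish.
\<close>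

lemma parallel_if_bch_deriv_fixed:
  assumes "bch_deriv v w = w" "w \<noteq> 0"
  shows "\<exists>c. v = c *\<^sub>R w"
proof (cases "v = 0")
  case False
  define s c where "s = 1 / sinhc (norm v)" and "c = v \<bullet> w / (v \<bullet> v)"
  have "s \<noteq> 1" using False sinhc_pos[of "norm v"] by (auto simp: s_def sinhc_eq_1_iff)
  have "(1 - s) *\<^sub>R (c *\<^sub>R v - w) = 0"
    using assms(1) by (simp add: bch_deriv_def s_def c_def algebra_simps)
  with \<open>s \<noteq> 1\<close> have "w = c *\<^sub>R v" by simp
  with assms(2) have "v = inverse c *\<^sub>R w" by auto
  then show ?thesis ..
qed (auto intro: exI[of _ 0])

definition spin_bch_deriv :: "real \<times> 'a::real_inner \<Rightarrow> real \<times> 'a \<Rightarrow> real \<times> 'a" where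
  "spin_bch_deriv X Y = (fst Y, bch_deriv (snd X) (snd Y))"

text \<open>
  The logarithms of the invertible effects: the largest eigenvalue of \<open>h + v \<cdot> \<sigma>\<close> is \<open>h + \<bar>v\<bar>\<close>.
\<close>

definition neg_cone :: "(real \<times> 'a::real_inner) set" where
  "neg_cone = {X. fst X + norm (snd X) \<le> 0}"

text \<open>
  Vectors \<open>y\<close> orthogonal to \<open>v\<close> are eigenvectors of \<open>bch_deriv v\<close> with eigenvalue \<open>s v < 1\<close>, whereas scalars
  are fixed. Comparing scalar parts, \<open>F\<close> cannot send a vector to something with a scalar part.
  If \<open>F\<close> sends \<open>(1, 0)\<close> to something with vector part \<open>w \<noteq> 0\<close>, all images are parallel to \<open>w\<close>, so the
  derivative acts trivially on them and the factor \<open>s v\<close> forces the vector images to vanish. If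
  \<open>w = 0\<close>, then \<open>R\<close> preserves orthogonality, \<open>R y\<close> is an eigenvector of \<open>bch_deriv (R v)\<close>, and equality of
  the eigenvalues gives \<open>\<bar>R v\<bar> = \<bar>v\<bar>\<close> whenever \<open>R y \<noteq> 0\<close> for some \<open>y\<close> orthogonal to \<open>v\<close>.
\<close>

lemma bch_deriv_intertwiner_form:
  fixes F :: "real \<times> 'a::euclidean_space \<Rightarrow> real \<times> 'a"
  assumes lin: "linear F" and dim: "2 \<le> DIM('a)"
    and F: "\<And>X Y. X \<in> neg_cone \<Longrightarrow> F (spin_bch_deriv X Y) = spin_bch_deriv (F X) (F Y)"
  shows "\<exists>k w R. linear R \<and> (\<forall>h v. F (h, v) = (k * h, h *\<^sub>R w + R v)) \<and>
    ((\<forall>v. R v = 0) \<or> w = 0 \<and> (\<forall>v. norm (R v) = norm v))"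
proof -
  define k w where "k = fst (F (1, 0))" and "w = snd (F (1, 0))"
  define g R where "g v = fst (F (0, v))" and "R v = snd (F (0, v))" for v
  define s :: "'a \<Rightarrow> real" where "s v = 1 / sinhc (norm v)" for v
  have linR: "linear R"
    unfolding R_def using lin
    by (intro linearI) (simp_all flip: snd_add snd_scaleR linear_add linear_scale)
  have split: "F (h, v) = (k * h + g v, h *\<^sub>R w + R v)" for h v
  proof -
    have "(h, v) = h *\<^sub>R (1, 0) + (0, v)" by simp
    then have "F (h, v) = h *\<^sub>R F (1, 0) + F (0, v)"
      using lin by (metis linear_add linear_scale)
    then show ?thesis by (simp add: k_def w_def g_def R_def prod_eq_iff mult.commute)
  qed
  have g_scale: "g (c *\<^sub>R v) = c * g v" for c v
    using linear_scale[OF lin, of c "(0, v)"] by (simp add: g_def)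
  have R_scale: "R (c *\<^sub>R v) = c *\<^sub>R R v" for c v using linR by (rule linear_scale)
  have ne1: "s v \<noteq> 1" if "v \<noteq> 0" for v
    using that sinhc_pos[of "norm v"] by (auto simp: s_def sinhc_eq_1_iff)
  have cone: "(- norm v, v) \<in> neg_cone" for v :: 'a by (simp add: neg_cone_def)
  have perp: "s v * g y = g y \<and> s v *\<^sub>R R y = bch_deriv (R v - norm v *\<^sub>R w) (R y)"
    if "v \<bullet> y = 0" for v y
    using F[OF cone[of v], of "(0, y)"] that
    by (simp add: spin_bch_deriv_def bch_deriv_orthogonal split g_scale R_scale flip: s_def)
  have central: "bch_deriv (R v - norm v *\<^sub>R w) w = w" for v
    using F[OF cone[of v], of "(1, 0)"] by (simp add: spin_bch_deriv_def split linear_0[OF linR])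
  have ex_perp: "\<exists>v. v \<noteq> 0 \<and> v \<bullet> y = 0" for y :: 'a
    using orthogonal_to_vector_exists[OF dim, of y] by (auto simp: orthogonal_def inner_commute)
  have g0: "g y = 0" for y
    using ex_perp[of y] perp ne1 by fastforce
  have "(\<forall>v. R v = 0) \<or> w = 0 \<and> (\<forall>v. norm (R v) = norm v)"
  proof (cases "w = 0")
    case False
    have par: "\<exists>c. R v = c *\<^sub>R w" for v
    proof -
      obtain c where "R v - norm v *\<^sub>R w = c *\<^sub>R w"
        using parallel_if_bch_deriv_fixed[OF central False] by blast
      then have "R v = (c + norm v) *\<^sub>R w" by (simp add: algebra_simps)
      then show ?thesis ..
    qed
    have "R y = 0" for y
    proof -
      obtain v where v: "v \<noteq> 0" "v \<bullet> y = 0" using ex_perp by blast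
      obtain a b where ab: "R v = a *\<^sub>R w" "R y = b *\<^sub>R w" using par by meson
      have "s v *\<^sub>R R y = bch_deriv ((a - norm v) *\<^sub>R w) (b *\<^sub>R w)"
        using perp[OF v(2)] by (simp add: ab algebra_simps)
      then have "s v *\<^sub>R R y = R y" by (simp only: bch_deriv_parallel ab)
      with ne1[OF v(1)] show ?thesis by (metis scaleR_cancel_right scaleR_one)
    qed
    then show ?thesis by blast
  next
    case True
    have orth: "R v \<bullet> R y = 0" if "v \<bullet> y = 0" for v y
    proof (cases "v = 0")
      case False
      have "R v \<bullet> (s v *\<^sub>R R y) = R v \<bullet> R y"
        using perp[OF that] True by (simp only: inner_bch_deriv scaleR_zero_right diff_zero)
      with ne1[OF False] show ?thesis by simp
    qed (simp add: linear_0[OF linR])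
    have iso: "norm (R v) = norm v" if "v \<bullet> y = 0" "R y \<noteq> 0" for v y
    proof -
      have "s v *\<^sub>R R y = (1 / sinhc (norm (R v))) *\<^sub>R R y"
        using perp[OF that(1)] bch_deriv_orthogonal[OF orth[OF that(1)]] True by simp
      then have "sinhc (norm v) = sinhc (norm (R v))"
        using that(2) sinhc_pos by (simp add: s_def)
      then show ?thesis using sinhc_inject[of "norm v" "norm (R v)"] by simp
    qed
    \<comment> \<open>one nonzero image suffices: lengths are preserved on its orthogonal complement, then on the line itself\<close>
    show ?thesis
    proof (cases "\<forall>v. R v = 0")
      case False
      then obtain y where y: "R y \<noteq> 0" by blast
      obtain v0 where v0: "v0 \<noteq> 0" "v0 \<bullet> y = 0" using ex_perp by blast
      have "R v0 \<noteq> 0" using iso[OF v0(2) y] v0(1) by auto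
      then have ny: "norm (R y) = norm y" using iso[of y v0] v0(2) by (simp add: inner_commute)
      have "norm (R v) = norm v" for v
      proof -
        define c z where "c = v \<bullet> y / (y \<bullet> y)" and "z = v - c *\<^sub>R y"
        have "y \<noteq> 0" using y linear_0[OF linR] by auto
        then have zy: "z \<bullet> y = 0" by (simp add: z_def c_def inner_diff_left)
        have v: "v = z + c *\<^sub>R y" by (simp add: z_def)
        have Rv: "R v = R z + c *\<^sub>R R y" unfolding v by (simp add: linear_add[OF linR] R_scale)
        have "(norm (R v))\<^sup>2 = (norm (R z))\<^sup>2 + (c * norm (R y))\<^sup>2"
          unfolding Rv using norm_add_Pythagorean[of "R z" "c *\<^sub>R R y"] orth[OF zy]
          by (simp add: orthogonal_def power_mult_distrib)
        also have "\<dots> = (norm z)\<^sup>2 + (c * norm y)\<^sup>2" by (simp only: ny iso[OF zy y])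
        also have "\<dots> = (norm v)\<^sup>2"
          unfolding v using norm_add_Pythagorean[of z "c *\<^sub>R y"] zy
          by (simp add: orthogonal_def power_mult_distrib)
        finally show ?thesis by simp
      qed
      with True show ?thesis by blast
    qed blast
  qed
  moreover have "F (h, v) = (k * h, h *\<^sub>R w + R v)" for h v using split g0 by simp
  ultimately show ?thesis using linR by blast
qed

section \<open>Unital sequential endomorphisms become linear on the logarithmic scale\<close>

definition spin_bch :: "real \<times> 'a::real_inner \<Rightarrow> real \<times> 'a \<Rightarrow> real \<times> 'a" where
  "spin_bch X Y = (fst X + fst Y, bch (snd X) (snd Y))"

lemma spin_exp_bch: "spin_prod (spin_exp X) (spin_exp Y) = spin_exp (spin_bch X Y)"
  by (simp add: spin_bch_def spin_prod_exp)

lemma neg_cone_iff: "X \<in> neg_cone \<longleftrightarrow> spin_exp X \<in> spin_effects"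
  by (simp add: neg_cone_def spin_exp_mem_effects_iff)

lemma neg_cone_bch: "X \<in> neg_cone \<Longrightarrow> Y \<in> neg_cone \<Longrightarrow> spin_bch X Y \<in> neg_cone"
  by (simp add: neg_cone_iff spin_prod_mem_effects flip: spin_exp_bch)

lemma neg_cone_add: "X \<in> neg_cone \<Longrightarrow> Y \<in> neg_cone \<Longrightarrow> X + Y \<in> neg_cone"
  using norm_triangle_ineq[of "snd X" "snd Y"] by (auto simp: neg_cone_def)

lemma neg_cone_scaleR: "X \<in> neg_cone \<Longrightarrow> 0 \<le> t \<Longrightarrow> t *\<^sub>R X \<in> neg_cone"
  using mult_left_mono[of "fst X + norm (snd X)" 0 t] by (simp add: neg_cone_def distrib_left)

lemma bch_self: "bch v v = 2 *\<^sub>R v"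
proof (cases "v = 0")
  case False
  define S C where "S = sinh (norm v)" and "C = cosh (norm v)"
  have "vsinh v \<bullet> vsinh v = S\<^sup>2" by (simp add: S_def flip: power2_norm_eq_inner)
  also have "\<dots> = (C - 1) * (C + 1)"
    unfolding S_def C_def sinh_square_eq by (simp add: power2_eq_square algebra_simps)
  finally have "vsinh v \<bullet> vsinh v / (C + 1) = C - 1"
    by (simp add: C_def add_pos_pos less_imp_neq[symmetric])
  then have "bch v v = varsinh ((C + 1 + (C - 1)) *\<^sub>R vsinh v)"
    unfolding bch_def C_def[symmetric] by (simp only: scaleR_add_left scaleR_one)
  also have "(C + 1 + (C - 1)) *\<^sub>R vsinh v = vsinh (2 *\<^sub>R v)"
    using False vsinh_scaleR[OF False, of 1]
    by (simp add: vsinh_scaleR sinh_double C_def)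
  finally show ?thesis by simp
qed simp

lemma spin_bch_self: "spin_bch X X = 2 *\<^sub>R X"
  by (simp add: spin_bch_def bch_self prod_eq_iff)

lemma spin_bch_trotter:
  "((\<lambda>t. spin_bch (t *\<^sub>R X) (t *\<^sub>R Y) /\<^sub>R t) \<longlongrightarrow> X + Y) (at_right 0)"
proof -
  have "((\<lambda>t. (fst X + fst Y, bch (t *\<^sub>R snd X) (t *\<^sub>R snd Y) /\<^sub>R t))
      \<longlongrightarrow> (fst X + fst Y, snd X + snd Y)) (at_right 0)"
    by (intro tendsto_intros bch_trotter)
  then have "((\<lambda>t. (fst X + fst Y, bch (t *\<^sub>R snd X) (t *\<^sub>R snd Y) /\<^sub>R t)) \<longlongrightarrow> X + Y) (at_right 0)"
    by (simp add: prod_eq_iff plus_prod_def)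
  then show ?thesis
    by (rule Lim_transform_eventually)
       (auto simp: spin_bch_def eventually_at divide_simps intro!: exI[of _ 1] simp flip: distrib_left)
qed

lemma spin_bch_derivative_at_0:
  "((\<lambda>t. (spin_bch X (t *\<^sub>R Y) - X) /\<^sub>R t) \<longlongrightarrow> spin_bch_deriv X Y) (at_right 0)"
proof -
  have "((\<lambda>t. (fst Y, (bch (snd X) (t *\<^sub>R snd Y) - snd X) /\<^sub>R t)) \<longlongrightarrow> spin_bch_deriv X Y) (at_right 0)"
    unfolding spin_bch_deriv_def by (intro tendsto_intros bch_derivative_at_0)
  then show ?thesis
    by (rule Lim_transform_eventually)
       (auto simp: spin_bch_def eventually_at prod_eq_iff intro!: exI[of _ 1])
qed

lemma tendsto_half_power_scaleR: "(\<lambda>n. (1 / 2) ^ n *\<^sub>R X) \<longlonglongrightarrow> 0" for X :: "'a::real_normed_vector"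
proof -
  have "(\<lambda>n. (1 / 2) ^ n *\<^sub>R X) \<longlonglongrightarrow> 0 *\<^sub>R X"
    by (intro tendsto_intros LIMSEQ_realpow_zero) auto
  then show ?thesis by simp
qed

locale unital_spin_endo =
  fixes \<phi> :: "real \<times> 'a::euclidean_space \<Rightarrow> real \<times> 'a"
  assumes maps: "p \<in> spin_effects \<Longrightarrow> \<phi> p \<in> spin_effects"
    and cont: "continuous_on spin_effects \<phi>"
    and mult: "p \<in> spin_effects \<Longrightarrow> q \<in> spin_effects \<Longrightarrow> \<phi> (spin_prod p q) = spin_prod (\<phi> p) (\<phi> q)"
    and unit: "\<phi> (1, 0) = (1, 0)"
begin

lemma \<phi>_tendsto:
  assumes "(X \<longlongrightarrow> X0) F" "X0 \<in> neg_cone" "eventually (\<lambda>i. X i \<in> neg_cone) F"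
  shows "((\<lambda>i. \<phi> (spin_exp (X i))) \<longlongrightarrow> \<phi> (spin_exp X0)) F"
  using assms
  by (intro continuous_on_tendsto_compose[OF cont] tendsto_spin_exp) (auto simp: neg_cone_iff)

text \<open>
  The determinants of the images of the iterated square roots of \<open>exp X\<close> are iterated square roots of the
  determinant of the image of \<open>exp X\<close>. They tend to one, so none of them is zero.
\<close>

lemma disc_pos:
  assumes "X \<in> neg_cone"
  shows "0 < spin_disc (\<phi> (spin_exp X))"
proof -
  define d where "d n = spin_disc (\<phi> (spin_exp ((1 / 2) ^ n *\<^sub>R X)))" for n
  have cone: "(1 / 2) ^ n *\<^sub>R X \<in> neg_cone" for n using assms by (simp add: neg_cone_scaleR)
  have \<phi>_cone: "\<phi> (spin_exp ((1 / 2) ^ n *\<^sub>R X)) \<in> spin_cone" for n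
    using maps cone[of n] by (auto simp: neg_cone_iff spin_effects_def)
  have sq: "d n = (d (Suc n))\<^sup>2" for n
  proof -
    let ?Y = "(1 / 2) ^ Suc n *\<^sub>R X"
    have "(1 / 2) ^ n *\<^sub>R X = spin_bch ?Y ?Y" by (simp add: spin_bch_self)
    then have "\<phi> (spin_exp ((1 / 2) ^ n *\<^sub>R X)) = spin_prod (\<phi> (spin_exp ?Y)) (\<phi> (spin_exp ?Y))"
      using cone[of "Suc n"] by (simp only: flip: spin_exp_bch) (simp add: mult neg_cone_iff)
    then show ?thesis unfolding d_def using \<phi>_cone[of "Suc n"]
      by (simp add: spin_disc_prod power2_eq_square)
  qed
  have "d \<longlonglongrightarrow> spin_disc (\<phi> (spin_exp 0))"
    unfolding d_def
    by (intro tendsto_spin_disc \<phi>_tendsto tendsto_half_power_scaleR) (simp_all add: cone, simp add: neg_cone_def)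
  then have "d \<longlonglongrightarrow> 1" by (simp add: unit spin_disc_def)
  moreover have "d n = 0" if "d 0 = 0" for n
  proof (induction n)
    case (Suc n)
    with sq[of n] show ?case by simp
  qed (fact that)
  ultimately have "d 0 \<noteq> 0"
    using LIMSEQ_unique[OF tendsto_const[of 0 sequentially], of 1] by (metis ext zero_neq_one)
  moreover have "0 \<le> d 0" using \<phi>_cone[of 0] by (simp add: d_def spin_cone_iff)
  ultimately show ?thesis by (simp add: d_def)
qed

definition log_map :: "real \<times> 'a \<Rightarrow> real \<times> 'a" where
  "log_map X = spin_log (\<phi> (spin_exp X))"

lemma exp_log_map:
  assumes "X \<in> neg_cone"
  shows "spin_exp (log_map X) = \<phi> (spin_exp X)"
proof -
  have "\<phi> (spin_exp X) \<in> spin_cone"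
    using maps assms by (auto simp: neg_cone_iff spin_effects_def)
  then show ?thesis unfolding log_map_def using disc_pos[OF assms] by (simp add: spin_exp_log)
qed

lemma log_map_mem: "X \<in> neg_cone \<Longrightarrow> log_map X \<in> neg_cone"
  using maps by (simp add: neg_cone_iff) (simp add: exp_log_map neg_cone_iff)

lemma log_map_bch:
  assumes "X \<in> neg_cone" "Y \<in> neg_cone"
  shows "log_map (spin_bch X Y) = spin_bch (log_map X) (log_map Y)"
proof -
  have "spin_exp (log_map (spin_bch X Y)) = spin_exp (spin_bch (log_map X) (log_map Y))"
    using assms
    by (simp add: exp_log_map neg_cone_bch flip: spin_exp_bch) (simp add: neg_cone_iff mult)
  then show ?thesis by (metis spin_log_exp)
qed

lemma log_map_tendsto:
  assumes "(X \<longlongrightarrow> X0) F" "X0 \<in> neg_cone" "eventually (\<lambda>i. X i \<in> neg_cone) F"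
  shows "((\<lambda>i. log_map (X i)) \<longlongrightarrow> log_map X0) F"
  unfolding log_map_def using assms disc_pos by (intro tendsto_spin_log \<phi>_tendsto)

lemma log_map_half_power: "X \<in> neg_cone \<Longrightarrow> log_map ((1 / 2) ^ n *\<^sub>R X) = (1 / 2) ^ n *\<^sub>R log_map X"
proof (induction n)
  case (Suc n)
  define Y where "Y = (1 / 2) ^ Suc n *\<^sub>R X"
  have Y: "Y \<in> neg_cone" "2 *\<^sub>R Y = (1 / 2) ^ n *\<^sub>R X"
    using Suc.prems by (auto simp: Y_def intro: neg_cone_scaleR)
  have "2 *\<^sub>R log_map Y = log_map (2 *\<^sub>R Y)"
    using log_map_bch[OF Y(1) Y(1)] by (simp only: spin_bch_self)
  also have "\<dots> = (1 / 2) ^ n *\<^sub>R log_map X" unfolding Y(2) using Suc by simp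
  finally have "(1 / 2) *\<^sub>R 2 *\<^sub>R log_map Y = (1 / 2) *\<^sub>R (1 / 2) ^ n *\<^sub>R log_map X" by (simp only:)
  then show ?case by (simp add: Y_def)
qed simp

text \<open>
  Only the scalings by powers of one half are available at this point, and they are enough to evaluate
  \<open>log_map\<close> along the Trotter approximations \<open>Z n\<close> of \<open>X + Y\<close>.
\<close>

lemma log_map_add:
  assumes X: "X \<in> neg_cone" and Y: "Y \<in> neg_cone"
  shows "log_map (X + Y) = log_map X + log_map Y"
proof -
  define t :: "nat \<Rightarrow> real" where "t n = (1 / 2) ^ n" for n
  have t: "filterlim t (at_right 0) sequentially"
    unfolding t_def using LIMSEQ_realpow_zero[of "1/2"]
    by (auto simp: filterlim_at)
  have t0: "0 < t n" for n by (simp add: t_def)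
  define Z where "Z n = spin_bch (t n *\<^sub>R X) (t n *\<^sub>R Y) /\<^sub>R t n" for n
  have mem: "t n *\<^sub>R X \<in> neg_cone" "t n *\<^sub>R Y \<in> neg_cone" "Z n \<in> neg_cone" for n
    using t0[of n] X Y by (auto simp: Z_def neg_cone_scaleR neg_cone_bch)
  have Z: "Z \<longlonglongrightarrow> X + Y"
    unfolding Z_def by (rule filterlim_compose[OF spin_bch_trotter t])
  have "log_map (Z n) = spin_bch (t n *\<^sub>R log_map X) (t n *\<^sub>R log_map Y) /\<^sub>R t n" for n
  proof -
    have "t n *\<^sub>R log_map (Z n) = log_map (t n *\<^sub>R Z n)"
      unfolding t_def by (simp add: log_map_half_power mem)
    also have "t n *\<^sub>R Z n = spin_bch (t n *\<^sub>R X) (t n *\<^sub>R Y)"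
      using t0[of n] by (simp add: Z_def)
    also have "log_map \<dots> = spin_bch (t n *\<^sub>R log_map X) (t n *\<^sub>R log_map Y)"
      using mem[of n] X Y by (simp add: log_map_bch) (simp add: t_def log_map_half_power)
    finally have "t n *\<^sub>R log_map (Z n) = spin_bch (t n *\<^sub>R log_map X) (t n *\<^sub>R log_map Y)" .
    moreover have "log_map (Z n) = (t n *\<^sub>R log_map (Z n)) /\<^sub>R t n" using t0[of n] by simp
    ultimately show ?thesis by (simp only:)
  qed
  then have "(\<lambda>n. log_map (Z n)) \<longlonglongrightarrow> log_map X + log_map Y"
    using filterlim_compose[OF spin_bch_trotter t] by simp
  moreover have "(\<lambda>n. log_map (Z n)) \<longlonglongrightarrow> log_map (X + Y)"
    by (rule log_map_tendsto[OF Z neg_cone_add[OF X Y]]) (simp add: mem)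
  ultimately show ?thesis by (rule LIMSEQ_unique[symmetric])
qed

lemma log_map_0: "log_map 0 = 0"
  using log_map_add[of 0 0] by (simp add: neg_cone_def)

lemma log_map_of_nat: "X \<in> neg_cone \<Longrightarrow> log_map (real n *\<^sub>R X) = real n *\<^sub>R log_map X"
  by (induction n) (simp_all add: log_map_0 scaleR_add_left log_map_add neg_cone_scaleR)

text \<open>
  Additivity gives rational factors; the rational approximations \<open>\<lfloor>m t\<rfloor> / m\<close> of \<open>t\<close> and continuity give
  the others.
\<close>

lemma log_map_scaleR:
  assumes X: "X \<in> neg_cone" and t: "0 \<le> t"
  shows "log_map (t *\<^sub>R X) = t *\<^sub>R log_map X"
proof -
  define q where "q n = real (nat \<lfloor>real (Suc n) * t\<rfloor>) / real (Suc n)" for n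
  have q0: "0 \<le> q n" for n by (simp add: q_def)
  have lq: "log_map (q n *\<^sub>R X) = q n *\<^sub>R log_map X" for n
  proof -
    let ?Y = "inverse (real (Suc n)) *\<^sub>R X"
    have Y: "?Y \<in> neg_cone" using X by (rule neg_cone_scaleR) simp
    have "log_map X = real (Suc n) *\<^sub>R log_map ?Y"
      using log_map_of_nat[OF Y, of "Suc n"] by (simp del: of_nat_Suc)
    moreover have "log_map (q n *\<^sub>R X) = real (nat \<lfloor>real (Suc n) * t\<rfloor>) *\<^sub>R log_map ?Y"
      using log_map_of_nat[OF Y, of "nat \<lfloor>real (Suc n) * t\<rfloor>"]
      by (simp add: q_def divide_inverse del: of_nat_Suc)
    ultimately show ?thesis by (simp add: q_def del: of_nat_Suc)
  qed
  have "q \<longlonglongrightarrow> t"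
  proof (rule tendsto_sandwich)
    show "eventually (\<lambda>n. t - 1 / real (Suc n) \<le> q n) sequentially"
    proof (intro always_eventually allI)
      fix n
      have "real (Suc n) * t - 1 \<le> real (nat \<lfloor>real (Suc n) * t\<rfloor>)" using t by linarith
      then have "(real (Suc n) * t - 1) / real (Suc n) \<le> q n"
        unfolding q_def by (rule divide_right_mono) simp
      then show "t - 1 / real (Suc n) \<le> q n"
        by (simp add: diff_divide_distrib del: of_nat_Suc)
    qed
    show "eventually (\<lambda>n. q n \<le> t) sequentially"
    proof (intro always_eventually allI)
      fix n
      have "0 \<le> real (Suc n) * t" using t by simp
      then have "real (nat \<lfloor>real (Suc n) * t\<rfloor>) \<le> real (Suc n) * t" by linarith
      then show "q n \<le> t" by (simp add: q_def pos_divide_le_eq mult.commute del: of_nat_Suc)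
    qed
    have "(\<lambda>n. t - 1 / real (Suc n)) \<longlonglongrightarrow> t - 0"
      by (intro tendsto_intros LIMSEQ_Suc[OF lim_1_over_n])
    then show "(\<lambda>n. t - 1 / real (Suc n)) \<longlonglongrightarrow> t" by simp
  qed simp
  then have "(\<lambda>n. log_map (q n *\<^sub>R X)) \<longlonglongrightarrow> log_map (t *\<^sub>R X)"
    using X t q0 by (intro log_map_tendsto tendsto_intros) (auto simp: neg_cone_scaleR)
  moreover have "(\<lambda>n. log_map (q n *\<^sub>R X)) \<longlonglongrightarrow> t *\<^sub>R log_map X"
    unfolding lq using \<open>q \<longlonglongrightarrow> t\<close> by (intro tendsto_intros)
  ultimately show ?thesis by (rule LIMSEQ_unique)
qed

text \<open>
  The cone generates the whole space: subtracting a large multiple of the identity moves any \<open>Z\<close> into it.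
\<close>

lemma ex_linear_extension: "\<exists>F. linear F \<and> (\<forall>X\<in>neg_cone. F X = log_map X)"
proof -
  define e :: "real \<times> 'a" where "e = (-1, 0)"
  define N where "N Z = \<bar>fst Z\<bar> + norm (snd Z)" for Z :: "real \<times> 'a"
  define F where "F Z = log_map (Z + N Z *\<^sub>R e) - log_map (N Z *\<^sub>R e)" for Z
  have mem: "Z + N Z *\<^sub>R e \<in> neg_cone" "N Z *\<^sub>R e \<in> neg_cone" for Z
  proof -
    have "0 \<le> N Z" by (simp add: N_def)
    then show "Z + N Z *\<^sub>R e \<in> neg_cone" "N Z *\<^sub>R e \<in> neg_cone"
      by (simp_all add: neg_cone_def e_def) (simp add: N_def)
  qed
  have well_defined: "F (X - Y) = log_map X - log_map Y" if "X \<in> neg_cone" "Y \<in> neg_cone" for X Y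
  proof -
    let ?Z = "X - Y"
    have "log_map (?Z + N ?Z *\<^sub>R e) + log_map Y = log_map X + log_map (N ?Z *\<^sub>R e)"
      using that mem[of ?Z] by (simp flip: log_map_add)
    then show ?thesis by (simp add: F_def algebra_simps)
  qed
  have decomp: "\<exists>X\<in>neg_cone. \<exists>Y\<in>neg_cone. Z = X - Y" for Z :: "real \<times> 'a"
    using mem[of Z] by (metis add_diff_cancel)
  have "linear F"
  proof (rule linearI)
    fix Z W :: "real \<times> 'a"
    obtain X Y X' Y' where XY: "X \<in> neg_cone" "Y \<in> neg_cone" "X' \<in> neg_cone" "Y' \<in> neg_cone"
      and ZW: "Z = X - Y" "W = X' - Y'" using decomp[of Z] decomp[of W] by blast
    have "Z + W = (X + X') - (Y + Y')" using ZW by simp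
    then have "F (Z + W) = log_map (X + X') - log_map (Y + Y')"
      using XY by (simp only: well_defined neg_cone_add)
    also have "\<dots> = F Z + F W" using XY by (simp add: ZW well_defined log_map_add)
    finally show "F (Z + W) = F Z + F W" .
  next
    fix c and Z :: "real \<times> 'a"
    obtain X Y where XY: "X \<in> neg_cone" "Y \<in> neg_cone" and Z: "Z = X - Y"
      using decomp[of Z] by blast
    show "F (c *\<^sub>R Z) = c *\<^sub>R F Z"
    proof (cases "0 \<le> c")
      case True
      then show ?thesis
        using XY well_defined[of "c *\<^sub>R X" "c *\<^sub>R Y"]
        by (simp add: Z well_defined log_map_scaleR neg_cone_scaleR scaleR_diff_right)
    next
      case False
      define d where "d = - c"
      have d: "0 \<le> d" "c = - d" using False by (simp_all add: d_def)
      have "c *\<^sub>R Z = d *\<^sub>R Y - d *\<^sub>R X" by (simp add: Z d(2) algebra_simps)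
      then have "F (c *\<^sub>R Z) = log_map (d *\<^sub>R Y) - log_map (d *\<^sub>R X)"
        using XY d(1) by (simp only: well_defined neg_cone_scaleR)
      also have "\<dots> = c *\<^sub>R F Z"
        using XY d(1) by (simp add: d(2) Z well_defined log_map_scaleR algebra_simps)
      finally show ?thesis .
    qed
  qed
  moreover have "F X = log_map X" if "X \<in> neg_cone" for X
    using well_defined[OF that, of 0] by (simp add: neg_cone_def log_map_0)
  ultimately show ?thesis by blast
qed

text \<open>
  The derivative at \<open>t = 0\<close> of the identity
  \<open>F (log (exp X \<circ> exp (t Y))) = log (exp (F X) \<circ> exp (t F Y))\<close>. It is obtained for \<open>Y\<close> in the cone and
  extended to all \<open>Y\<close> by linearity.
\<close>

lemma linear_extension_bch_deriv:
  assumes lin: "linear F" and F: "\<And>X. X \<in> neg_cone \<Longrightarrow> F X = log_map X"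
    and X: "X \<in> neg_cone"
  shows "F (spin_bch_deriv X Y) = spin_bch_deriv (F X) (F Y)"
proof -
  have cone: "F (spin_bch_deriv X Y) = spin_bch_deriv (F X) (F Y)" if Y: "Y \<in> neg_cone" for Y
  proof -
    have "((\<lambda>t. F ((spin_bch X (t *\<^sub>R Y) - X) /\<^sub>R t)) \<longlongrightarrow> F (spin_bch_deriv X Y)) (at_right 0)"
      by (intro bounded_linear.tendsto[OF linear_conv_bounded_linear[THEN iffD1, OF lin]]
          spin_bch_derivative_at_0)
    moreover have "F ((spin_bch X (t *\<^sub>R Y) - X) /\<^sub>R t)
        = (spin_bch (F X) (t *\<^sub>R F Y) - F X) /\<^sub>R t" if "0 < t" for t
      using that X Y lin
      by (simp add: linear_scale linear_diff F log_map_bch log_map_scaleR neg_cone_bch neg_cone_scaleR)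
    then have "eventually (\<lambda>t. F ((spin_bch X (t *\<^sub>R Y) - X) /\<^sub>R t)
        = (spin_bch (F X) (t *\<^sub>R F Y) - F X) /\<^sub>R t) (at_right 0)"
      by (auto simp: eventually_at intro!: exI[of _ 1])
    ultimately have "((\<lambda>t. (spin_bch (F X) (t *\<^sub>R F Y) - F X) /\<^sub>R t)
        \<longlongrightarrow> F (spin_bch_deriv X Y)) (at_right 0)"
      by (rule Lim_transform_eventually)
    from tendsto_unique[OF _ this spin_bch_derivative_at_0] show ?thesis by simp
  qed
  have lin_deriv: "linear (spin_bch_deriv Z)" for Z :: "real \<times> 'a"
    by (intro linearI) (simp_all add: spin_bch_deriv_def bch_deriv_def inner_add_right
        add_divide_distrib algebra_simps)
  define n where "n = \<bar>fst Y\<bar> + norm (snd Y)"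
  have "0 \<le> n" by (simp add: n_def)
  then have mem: "Y + (- n, 0) \<in> neg_cone" "(- n, 0 :: 'a) \<in> neg_cone"
    by (simp_all add: neg_cone_def) (simp add: n_def)
  obtain P Q where PQ: "P \<in> neg_cone" "Q \<in> neg_cone" "Y = P - Q"
    using mem by (metis add_diff_cancel)
  then show ?thesis
    by (simp add: linear_diff[OF lin] linear_diff[OF lin_deriv] cone)
qed

text \<open>
  The inequalities on \<open>k\<close> express that \<open>F\<close> maps the cone to itself, tested at \<open>(-1, 0)\<close> and at a
  boundary point \<open>(-1, v)\<close> with \<open>\<bar>v\<bar> = 1\<close>.
\<close>

lemma form_on_invertible:
  assumes dim: "2 \<le> DIM('a)"
  shows "\<exists>k w R. linear R \<and>
    (\<forall>h v. h + norm v \<le> 0 \<longrightarrow> \<phi> (spin_exp (h, v)) = spin_exp (k * h, h *\<^sub>R w + R v)) \<and>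
    ((\<forall>v. R v = 0) \<and> norm w \<le> k \<or> w = 0 \<and> 1 \<le> k \<and> (\<forall>v. norm (R v) = norm v))"
proof -
  obtain F where lin: "linear F" and F: "\<And>X. X \<in> neg_cone \<Longrightarrow> F X = log_map X"
    using ex_linear_extension by blast
  obtain k w R where R: "linear R" and FkwR: "\<And>h v. F (h, v) = (k * h, h *\<^sub>R w + R v)"
    and cases: "(\<forall>v. R v = 0) \<or> w = 0 \<and> (\<forall>v. norm (R v) = norm v)"
    using bch_deriv_intertwiner_form[OF lin dim] linear_extension_bch_deriv[OF lin F] by metis
  have Fmem: "F X \<in> neg_cone" if "X \<in> neg_cone" for X
    using that by (simp add: F log_map_mem)
  have "\<phi> (spin_exp (h, v)) = spin_exp (k * h, h *\<^sub>R w + R v)" if "h + norm v \<le> 0" for h v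
    using exp_log_map[of "(h, v)"] F[of "(h, v)"] that FkwR by (simp add: neg_cone_def)
  moreover have "norm w \<le> k"
    using Fmem[of "(-1, 0)"] by (simp add: neg_cone_def FkwR linear_0[OF R])
  moreover have "1 \<le> k" if "w = 0" "\<forall>v. norm (R v) = norm v"
  proof -
    obtain v :: 'a where v: "v \<in> Basis" using nonempty_Basis by blast
    then show ?thesis using Fmem[of "(- 1, v)"] that by (simp add: neg_cone_def FkwR)
  qed
  ultimately show ?thesis using R cases by blast
qed

end

section \<open>Classification in Bloch coordinates\<close>

definition rpow :: "real \<Rightarrow> real \<Rightarrow> real" where
  "rpow d c = (if c = 0 then 1 else d powr c)"

lemma rpow_exp: "rpow ((exp h)\<^sup>2) c = exp (2 * c * h)"
  by (simp add: rpow_def powr_def ln_realpow)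

lemma continuous_on_rpow_disc:
  assumes "0 \<le> c"
  shows "continuous_on spin_effects (\<lambda>p. rpow (spin_disc p) c)"
proof (cases "c = 0")
  case False
  have "continuous_on spin_effects (\<lambda>p. spin_disc p powr c)"
    using assms False
    by (intro continuous_on_powr' continuous_intros)
       (auto simp: spin_effects_def spin_cone_iff spin_disc_def intro!: continuous_intros)
  then show ?thesis using False by (simp add: rpow_def)
qed (simp add: rpow_def)

text \<open>
  Every effect is the limit of invertible ones along the segment that joins it to the identity.
\<close>

lemma eq_on_effects_if_eq_on_invertible:
  fixes f g :: "real \<times> 'a::euclidean_space \<Rightarrow> 'b::t2_space"
  assumes "continuous_on spin_effects f" "continuous_on spin_effects g"
    and eq: "\<And>p. p \<in> spin_effects \<Longrightarrow> 0 < spin_disc p \<Longrightarrow> f p = g p"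
    and p: "p \<in> spin_effects"
  shows "f p = g p"
proof -
  obtain a x where ax: "p = (a, x)" by fastforce
  define P where "P t = (1 - t) *\<^sub>R p + t *\<^sub>R (1, 0)" for t :: real
  have P: "P t \<in> spin_effects \<and> 0 < spin_disc (P t)" if t: "0 < t" "t < 1" for t
  proof -
    have Pt: "P t = ((1 - t) * a + t, (1 - t) *\<^sub>R x)" by (simp add: P_def ax)
    have x: "(1 - t) * norm x \<le> (1 - t) * a" "(1 - t) * (a + norm x) \<le> (1 - t) * 1"
      using p t by (auto simp: ax spin_effects_iff intro!: mult_left_mono)
    then have mem: "P t \<in> spin_effects"
    proof -
      have "(1 - t) * norm x \<le> (1 - t) * a + t" using x(1) t by linarith
      moreover have "(1 - t) * a + t + (1 - t) * norm x \<le> 1" using x(2) by (simp add: distrib_left)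
      ultimately show ?thesis using t by (simp add: Pt spin_effects_iff)
    qed
    have "(1 - t) * norm x < (1 - t) * a + t" using x(1) t by linarith
    then have "norm (snd (P t)) < fst (P t)" using t by (simp add: Pt)
    then have "(norm (snd (P t)))\<^sup>2 < (fst (P t))\<^sup>2" by (intro power_strict_mono) auto
    with mem show ?thesis by (simp add: spin_disc_def power2_norm_eq_inner)
  qed
  have "(P \<longlongrightarrow> (1 - 0) *\<^sub>R p + 0 *\<^sub>R (1, 0)) (at_right 0)"
    unfolding P_def by (intro tendsto_intros)
  then have lim: "(P \<longlongrightarrow> p) (at_right 0)" by (simp flip: zero_prod_def)
  have ev: "eventually (\<lambda>t. P t \<in> spin_effects \<and> f (P t) = g (P t)) (at_right 0)"
  proof -
    have "P t \<in> spin_effects \<and> f (P t) = g (P t)" if "0 < t" "t < 1" for t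
      using P[OF that] eq[of "P t"] by simp
    then show ?thesis by (auto simp: eventually_at intro!: exI[of _ 1])
  qed
  have "((\<lambda>t. f (P t)) \<longlongrightarrow> f p) (at_right 0)" "((\<lambda>t. g (P t)) \<longlongrightarrow> g p) (at_right 0)"
    using ev p lim assms(1,2)
    by (auto intro!: continuous_on_tendsto_compose[of spin_effects] elim: eventually_mono)
  moreover have "((\<lambda>t. g (P t)) \<longlongrightarrow> f p) (at_right 0)"
    by (rule Lim_transform_eventually[OF calculation(1)]) (use ev in \<open>auto elim: eventually_mono\<close>)
  ultimately show ?thesis using tendsto_unique[of "at_right (0::real)"] by auto
qed

lemma ex_spin_exp:
  assumes "p \<in> spin_effects" "0 < spin_disc p"
  obtains h v where "p = spin_exp (h, v)" "h + norm v \<le> 0"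
proof -
  have "spin_exp (spin_log p) = p" using assms by (simp add: spin_exp_log spin_effects_def)
  with assms(1) that[of "fst (spin_log p)" "snd (spin_log p)"] show ?thesis
    using spin_exp_mem_effects_iff[of "spin_log p"] by simp
qed

context unital_spin_endo
begin

lemma classification:
  assumes dim: "2 \<le> DIM('a)"
  shows "(\<exists>c R. 0 \<le> c \<and> linear R \<and> (\<forall>v. norm (R v) = norm v) \<and>
      (\<forall>p\<in>spin_effects. \<phi> p = rpow (spin_disc p) c *\<^sub>R (fst p, R (snd p)))) \<or>
    (\<exists>c1 c2 n. 0 \<le> c1 \<and> 0 \<le> c2 \<and> norm n = 1 \<and>
      (\<forall>p\<in>spin_effects. \<phi> p =
        ((rpow (spin_disc p) c1 + rpow (spin_disc p) c2) / 2,
         ((rpow (spin_disc p) c1 - rpow (spin_disc p) c2) / 2) *\<^sub>R n)))"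
proof -
  obtain k w R where R: "linear R"
    and form: "\<And>h v. h + norm v \<le> 0 \<Longrightarrow> \<phi> (spin_exp (h, v)) = spin_exp (k * h, h *\<^sub>R w + R v)"
    and cases: "(\<forall>v. R v = 0) \<and> norm w \<le> k \<or> w = 0 \<and> 1 \<le> k \<and> (\<forall>v. norm (R v) = norm v)"
    using form_on_invertible[OF dim] by blast
  show ?thesis
  proof (cases "\<forall>v. R v = 0")
    case False
    with cases have iso: "w = 0" "1 \<le> k" "\<And>v. norm (R v) = norm v" by auto
    \<comment> \<open>\<open>exp ((k - 1) h)\<close> is the power \<open>(k - 1) / 2\<close> of the determinant \<open>exp (2 h)\<close>\<close>
    define c where "c = (k - 1) / 2"
    have c: "0 \<le> c" using iso by (simp add: c_def)
    have "\<phi> p = rpow (spin_disc p) c *\<^sub>R (fst p, R (snd p))" if "p \<in> spin_effects" for p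
    proof (rule eq_on_effects_if_eq_on_invertible[OF cont _ _ that])
      show "continuous_on spin_effects (\<lambda>p. rpow (spin_disc p) c *\<^sub>R (fst p, R (snd p)))"
        by (intro continuous_intros continuous_on_rpow_disc c
            bounded_linear.continuous_on[OF linear_conv_bounded_linear[THEN iffD1, OF R]])
    next
      fix p :: "real \<times> 'a" assume "p \<in> spin_effects" "0 < spin_disc p"
      then obtain h v where p: "p = spin_exp (h, v)" and hv: "h + norm v \<le> 0"
        by (rule ex_spin_exp)
      have "vsinh (R v) = R (vsinh v)" by (simp add: vsinh_def iso linear_scale[OF R])
      moreover
      have "2 * c = k - 1" by (simp add: c_def)
      then have "k * h = 2 * c * h + h" by (simp only: left_diff_distrib)
      then have "exp (k * h) = exp (2 * c * h) * exp h" by (simp only: exp_add)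
      ultimately show "\<phi> p = rpow (spin_disc p) c *\<^sub>R (fst p, R (snd p))"
        unfolding p form[OF hv] spin_disc_exp fst_conv rpow_exp
        by (simp add: spin_exp_def iso linear_scale[OF R])
    qed
    with c R iso(3) show ?thesis by blast
  next
    case True
    have "norm w \<le> k"
    proof (rule ccontr)
      assume "\<not> norm w \<le> k"
      with cases have "\<forall>v::'a. norm (R v) = norm v" by blast
      with True nonzero_Basis nonempty_Basis show False by (metis ex_in_conv norm_eq_zero)
    qed
    \<comment> \<open>\<open>k + \<bar>w\<bar>\<close> and \<open>k - \<bar>w\<bar>\<close> are the eigenvalues of \<open>k + w \<cdot> \<sigma>\<close>; the factor one half is as before\<close>
    define c1 c2 where "c1 = (k + norm w) / 2" and "c2 = (k - norm w) / 2"
    have "0 \<le> k" using \<open>norm w \<le> k\<close> norm_ge_zero order_trans by blast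
    then have c: "0 \<le> c1" "0 \<le> c2"
      using \<open>norm w \<le> k\<close> by (auto simp: c1_def c2_def)
    obtain n where n: "norm n = 1" "w = norm w *\<^sub>R n"
    proof (cases "w = 0")
      case True
      obtain b :: 'a where "b \<in> Basis" using nonempty_Basis by blast
      with that[of b] True show ?thesis by simp
    next
      case False
      with that[of "sgn w"] show ?thesis by (simp add: norm_sgn sgn_div_norm)
    qed
    have "\<phi> p = ((rpow (spin_disc p) c1 + rpow (spin_disc p) c2) / 2,
         ((rpow (spin_disc p) c1 - rpow (spin_disc p) c2) / 2) *\<^sub>R n)" if "p \<in> spin_effects" for p
    proof (rule eq_on_effects_if_eq_on_invertible[OF cont _ _ that])
      show "continuous_on spin_effects (\<lambda>p. ((rpow (spin_disc p) c1 + rpow (spin_disc p) c2) / 2,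
         ((rpow (spin_disc p) c1 - rpow (spin_disc p) c2) / 2) *\<^sub>R n))"
        by (intro continuous_intros continuous_on_rpow_disc c) auto
    next
      fix p :: "real \<times> 'a" assume "p \<in> spin_effects" "0 < spin_disc p"
      then obtain h v where p: "p = spin_exp (h, v)" and hv: "h + norm v \<le> 0"
        by (rule ex_spin_exp)
      define m where "m = h * norm w"
      have hw: "h *\<^sub>R w = m *\<^sub>R n" unfolding m_def by (subst n(2)) simp
      have n0: "n \<noteq> 0" using n(1) by auto
      have e: "exp (2 * c1 * h) = exp (k * h) * exp m" "exp (2 * c2 * h) = exp (k * h) * exp (- m)"
      proof -
        have "2 * c1 = k + norm w" "2 * c2 = k - norm w" by (simp_all add: c1_def c2_def)
        then have "2 * c1 * h = k * h + m" "2 * c2 * h = k * h + - m"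
          by (simp_all only: m_def distrib_right left_diff_distrib) (simp_all add: mult.commute)
        then show "exp (2 * c1 * h) = exp (k * h) * exp m" "exp (2 * c2 * h) = exp (k * h) * exp (- m)"
          by (simp_all only: exp_add)
      qed
      have "\<phi> p = spin_exp (k * h, m *\<^sub>R n)" using form[OF hv] True by (simp add: p hw)
      also have "\<dots> = exp (k * h) *\<^sub>R (cosh m, sinh m *\<^sub>R n)"
        using n0 n(1) by (simp add: spin_exp_def vsinh_scaleR)
      finally show "\<phi> p = ((rpow (spin_disc p) c1 + rpow (spin_disc p) c2) / 2,
         ((rpow (spin_disc p) c1 - rpow (spin_disc p) c2) / 2) *\<^sub>R n)"
        unfolding p spin_disc_exp fst_conv rpow_exp e
        by (simp add: cosh_def sinh_def distrib_left right_diff_distrib diff_divide_distrib)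
    qed
    with c n(1) show ?thesis by blast
  qed
qed

end

lemma spin_prod_idempotent:
  assumes e: "e \<in> spin_cone" "spin_prod e e = e"
  shows "e = (1, 0) \<or> e = 0 \<or> (\<exists>n. norm n = 1 \<and> e = (1 / 2) *\<^sub>R (1, n))"
proof -
  obtain a x where ax: "e = (a, x)" by fastforce
  define d where "d = sqrt (a\<^sup>2 - x \<bullet> x)"
  have d: "0 \<le> d" "d\<^sup>2 = a\<^sup>2 - x \<bullet> x" "0 \<le> a"
    using e(1) by (auto simp: d_def ax spin_cone_iff spin_disc_def)
  have a: "a * a + x \<bullet> x = a" and x: "(a + d + x \<bullet> x / (a + d)) *\<^sub>R x = x"
    using e(2) by (simp_all add: ax spin_prod_def spin_disc_def scaleR_add_left flip: d_def)
  show ?thesis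
  proof (cases "x = 0")
    case True
    with a have "a = 0 \<or> a = 1" by simp
    with True show ?thesis by (auto simp: ax zero_prod_def)
  next
    case False
    have pos: "0 < a + d"
    proof (rule ccontr)
      assume "\<not> 0 < a + d"
      with d have "a = 0" "d = 0" by linarith+
      with a False show False by simp
    qed
    have "x \<bullet> x = (a - d) * (a + d)" using d(2) by (simp add: power2_eq_square algebra_simps)
    then have "x \<bullet> x / (a + d) = a - d" using pos by simp
    with x have "(2 * a) *\<^sub>R x = 1 *\<^sub>R x" by simp
    with False have "a = 1 / 2" by (simp only: scaleR_cancel_right) simp
    with a have "x \<bullet> x = (1 / 2)\<^sup>2" by (simp add: power_divide)
    then have "(norm x)\<^sup>2 = (1 / 2)\<^sup>2" by (simp only: power2_norm_eq_inner)
    then have "norm x = 1 / 2" by (rule power2_eq_imp_eq) simp_all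
    then have "norm (2 *\<^sub>R x) = 1 \<and> e = (1 / 2) *\<^sub>R (1, 2 *\<^sub>R x)"
      using \<open>a = 1 / 2\<close> by (simp add: ax)
    then show ?thesis by blast
  qed
qed

text \<open>
  The vector \<open>(1, n) / 2\<close> is a projection of rank one, and \<open>P B P = tr(P B) P\<close>.
\<close>

lemma spin_prod_half_projection:
  assumes "norm n = 1" "0 \<le> s"
  shows "spin_prod (s *\<^sub>R (1, n)) (b, y) = (s * (b + n \<bullet> y)) *\<^sub>R (1, n)"
proof -
  have "spin_disc (s *\<^sub>R (1, n)) = 0"
    using assms by (simp add: spin_disc_def power2_eq_square norm_eq_1)
  then show ?thesis
    by (cases "s = 0") (simp_all add: spin_prod_def scaleR_add_left algebra_simps)
qed

text \<open>
  Compression by the projection \<open>\<phi>(1)\<close> shows that \<open>\<phi>\<close> is this projection times a scalar function \<open>\<tau>\<close>,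
  and \<open>p \<mapsto> (\<tau> p, 0)\<close> is again an endomorphism, now unital. Of the two forms of the classification the one
  with an isometry is impossible for it, since the vector parts vanish, and the other one reduces to a
  single power.
\<close>

lemma rank_one_spin_endo:
  fixes \<phi> :: "real \<times> 'a::euclidean_space \<Rightarrow> real \<times> 'a"
  assumes dim: "2 \<le> DIM('a)"
    and maps: "\<And>p. p \<in> spin_effects \<Longrightarrow> \<phi> p \<in> spin_effects"
    and cont: "continuous_on spin_effects \<phi>"
    and mult: "\<And>p q. p \<in> spin_effects \<Longrightarrow> q \<in> spin_effects \<Longrightarrow> \<phi> (spin_prod p q) = spin_prod (\<phi> p) (\<phi> q)"
    and n: "norm n = 1" and unit: "\<phi> (1, 0) = (1 / 2) *\<^sub>R (1, n)"
  obtains c where "0 \<le> c" "\<And>p. p \<in> spin_effects \<Longrightarrow> \<phi> p = (rpow (spin_disc p) c / 2) *\<^sub>R (1, n)"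
proof -
  define \<tau> where "\<tau> p = 2 * fst (\<phi> p)" for p
  have one: "(1, 0) \<in> spin_effects" by (simp add: spin_effects_iff)
  have \<phi>: "\<phi> p = (\<tau> p / 2) *\<^sub>R (1, n)" if "p \<in> spin_effects" for p
  proof -
    obtain b y where \<phi>p: "\<phi> p = (b, y)" by fastforce
    have "\<phi> p = spin_prod (\<phi> (1, 0)) (\<phi> p)"
      using mult[OF one that] by simp
    then have "\<phi> p = ((b + n \<bullet> y) / 2) *\<^sub>R (1, n)"
      unfolding unit by (simp add: \<phi>p spin_prod_half_projection[OF n, of "1/2"] del: scaleR_Pair)
    then show ?thesis by (simp add: \<tau>_def)
  qed
  have \<tau>: "0 \<le> \<tau> p" "\<tau> p \<le> 1" if "p \<in> spin_effects" for p
  proof -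
    have "(\<tau> p / 2, (\<tau> p / 2) *\<^sub>R n) \<in> spin_effects" using maps[OF that] \<phi>[OF that] by simp
    then show "0 \<le> \<tau> p" "\<tau> p \<le> 1" using n by (auto simp: spin_effects_iff)
  qed
  interpret unital_spin_endo "\<lambda>p. (\<tau> p, 0 :: 'a)"
  proof
    show "(\<tau> p, 0 :: 'a) \<in> spin_effects" if "p \<in> spin_effects" for p
      using \<tau>[OF that] by (simp add: spin_effects_iff)
    show "continuous_on spin_effects (\<lambda>p. (\<tau> p, 0 :: 'a))"
      unfolding \<tau>_def by (intro continuous_intros cont)
    show "(\<tau> (1, 0), 0 :: 'a) = (1, 0)" by (simp add: \<tau>_def unit)
    fix p q :: "real \<times> 'a" assume pq: "p \<in> spin_effects" "q \<in> spin_effects"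
    have "\<phi> (spin_prod p q) = spin_prod ((\<tau> p / 2) *\<^sub>R (1, n)) (\<tau> q / 2, (\<tau> q / 2) *\<^sub>R n)"
      using mult[OF pq] \<phi>[OF pq(1)] \<phi>[OF pq(2)] by simp
    also have "\<dots> = (\<tau> p / 2 * (\<tau> q / 2 + n \<bullet> ((\<tau> q / 2) *\<^sub>R n))) *\<^sub>R (1, n)"
      using \<tau>[OF pq(1)] by (intro spin_prod_half_projection n) simp
    finally have "\<tau> (spin_prod p q) = \<tau> p * \<tau> q"
      using n by (simp add: \<tau>_def norm_eq_1)
    then show "(\<tau> (spin_prod p q), 0 :: 'a) = spin_prod (\<tau> p, 0) (\<tau> q, 0)"
      by (simp add: spin_prod_def)
  qed
  have "\<exists>c. 0 \<le> c \<and> (\<forall>p\<in>spin_effects. \<tau> p = rpow (spin_disc p) c)"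
    using classification[OF dim]
  proof (elim disjE exE conjE)
    fix c R assume R: "\<forall>v::'a. norm (R v) = norm v"
      and eq: "\<forall>p\<in>spin_effects. (\<tau> p, 0 :: 'a) = rpow (spin_disc p) c *\<^sub>R (fst p, R (snd p))"
    obtain b :: 'a where b: "norm b = 1" using nonempty_Basis norm_Basis by blast
    define p where "p = (1 / 2 :: real, (1 / 4) *\<^sub>R b)"
    have "p \<in> spin_effects" by (simp add: p_def spin_effects_iff b)
    with eq have "rpow (spin_disc p) c *\<^sub>R R (snd p) = 0" by simp
    moreover have "spin_disc p \<noteq> 0"
      using b by (simp add: spin_disc_def p_def norm_eq_1 power2_eq_square)
    moreover have "norm (R (snd p)) \<noteq> 0" using b by (simp add: R p_def)
    then have "R (snd p) \<noteq> 0" by force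
    ultimately show ?thesis by (simp add: rpow_def split: if_splits)
  next
    fix c1 c2 and m :: 'a assume c: "0 \<le> c1" and m: "norm m = 1"
      and eq: "\<forall>p\<in>spin_effects. (\<tau> p, 0) = ((rpow (spin_disc p) c1 + rpow (spin_disc p) c2) / 2,
         ((rpow (spin_disc p) c1 - rpow (spin_disc p) c2) / 2) *\<^sub>R m)"
    have "m \<noteq> 0" using m by auto
    with eq c show ?thesis by (intro exI[of _ c1]) fastforce
  qed
  then show ?thesis using that \<phi> by fastforce
qed

section \<open>Hermitian matrices of size two\<close>

lemma mat2_eq_iff: "A = B \<longleftrightarrow> A$1$1 = B$1$1 \<and> A$1$2 = B$1$2 \<and> A$2$1 = B$2$1 \<and> A$2$2 = B$2$2"
  for A B :: "'a^2^2"
  by (auto simp: vec_eq_iff forall_2)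

lemma mat2_mult_entries:
  "(A ** B)$i$j = A$i$1 * B$1$j + A$i$2 * B$2$j" for A B :: "complex^2^2"
  by (simp add: matrix_matrix_mult_def sum_2)

lemma conj_transpose_entries: "conj_transpose A $ i $ j = cnj (A $ j $ i)"
  by (simp add: conj_transpose_def)

definition herm :: "real \<times> (real^3) \<Rightarrow> complex^2^2" where
  "herm p = vector [vector [complex_of_real (fst p + snd p $ 3), Complex (snd p $ 1) (- snd p $ 2)],
                    vector [Complex (snd p $ 1) (snd p $ 2), complex_of_real (fst p - snd p $ 3)]]"

definition bloch :: "complex^2^2 \<Rightarrow> real \<times> (real^3)" where
  "bloch A = ((Re (A$1$1) + Re (A$2$2)) / 2,
              vector [Re (A$2$1), Im (A$2$1), (Re (A$1$1) - Re (A$2$2)) / 2])"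

lemma herm_entries [simp]:
  "herm p $ 1 $ 1 = complex_of_real (fst p + snd p $ 3)"
  "herm p $ 1 $ 2 = Complex (snd p $ 1) (- snd p $ 2)"
  "herm p $ 2 $ 1 = Complex (snd p $ 1) (snd p $ 2)"
  "herm p $ 2 $ 2 = complex_of_real (fst p - snd p $ 3)"
  by (simp_all add: herm_def)

lemma inner_3: "x \<bullet> y = x$1 * y$1 + x$2 * y$2 + x$3 * y$3" for x y :: "real^3"
  by (simp add: inner_vec_def sum_3)

lemma bloch_herm [simp]: "bloch (herm p) = p"
  by (simp add: bloch_def prod_eq_iff vec_eq_iff forall_3)

lemma herm_inject [simp]: "herm p = herm q \<longleftrightarrow> p = q"
  by (metis bloch_herm)

lemma herm_bloch:
  assumes "self_adjoint A"
  shows "herm (bloch A) = A"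
proof -
  have cnj: "cnj (A $ j $ i) = A $ i $ j" for i j
    using assms unfolding self_adjoint_def vec_eq_iff conj_transpose_entries by blast
  have "Im (A$1$1) = 0" "Im (A$2$2) = 0" "Re (A$1$2) = Re (A$2$1)" "Im (A$1$2) = - Im (A$2$1)"
    using arg_cong[OF cnj[of 1 1], of Im] arg_cong[OF cnj[of 2 2], of Im]
      arg_cong[OF cnj[of 2 1], of Re] arg_cong[OF cnj[of 2 1], of Im] by simp_all
  then show ?thesis
    by (simp add: mat2_eq_iff bloch_def complex_eq_iff field_simps)
qed

lemma self_adjoint_herm [simp]: "self_adjoint (herm p)"
  by (simp add: self_adjoint_def mat2_eq_iff conj_transpose_entries complex_eq_iff)

lemma herm_diff: "herm p - herm q = herm (p - q)" and herm_scaleR: "c *\<^sub>R herm p = herm (c *\<^sub>R p)"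
  by (simp_all add: mat2_eq_iff complex_eq_iff algebra_simps)

lemma mat_1_eq_herm: "mat 1 = herm (1, 0)"
  by (simp add: mat2_eq_iff mat_def complex_eq_iff)

lemma linear_herm: "linear herm"
  by (intro linearI) (simp_all add: mat2_eq_iff complex_eq_iff algebra_simps)

lemma linear_bloch: "linear bloch"
  by (intro linearI)
     (simp_all add: bloch_def prod_eq_iff vec_eq_iff forall_3 algebra_simps add_divide_distrib diff_divide_distrib)

lemma continuous_on_herm: "continuous_on S herm"
  using linear_herm linear_continuous_on linear_conv_bounded_linear by blast

lemma continuous_on_bloch: "continuous_on S bloch"
  using linear_bloch linear_continuous_on linear_conv_bounded_linear by blast

lemma det_herm: "det (herm p) = complex_of_real (spin_disc p)"
  by (simp add: det_2 spin_disc_def inner_3 complex_eq_iff power2_eq_square algebra_simps)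

lemma herm_quadratic_form:
  "Re (\<Sum>i\<in>UNIV. cnj (z $ i) * (herm p *v z) $ i)
    = (fst p + snd p $ 3) * (norm (z$1))\<^sup>2 + (fst p - snd p $ 3) * (norm (z$2))\<^sup>2
      + 2 * (snd p $ 1 * Re (cnj (z$1) * z$2) + snd p $ 2 * Im (cnj (z$1) * z$2))"
  unfolding cmod_power2
  by (simp add: sum_2 matrix_vector_mult_def algebra_simps power2_eq_square)

text \<open>
  For one direction the quadratic form is tested on the standard basis and on vectors with a free real
  parameter \<open>c\<close>; when \<open>c\<close> is a diagonal entry these are columns of the adjugate matrix up to sign,
  and the form takes that entry times the determinant as its value. For the other, the quadratic form at \<open>z\<close> is
  \<open>a N + x \<cdot> y\<close>, where \<open>(N, y)\<close> are Bloch coordinates of twice the rank one matrix of \<open>z\<close> and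
  \<open>\<bar>y\<bar> = N\<close>, so that the Cauchy--Schwarz inequality applies.
\<close>

lemma pos_semidef_herm_iff: "pos_semidef (herm p) \<longleftrightarrow> p \<in> spin_cone"
proof
  assume psd: "pos_semidef (herm p)"
  define a x1 x2 x3 where "a = fst p" and "x1 = snd p $ 1" and "x2 = snd p $ 2" and "x3 = snd p $ 3"
  have Q: "0 \<le> (a + x3) * ((Re z)\<^sup>2 + (Im z)\<^sup>2) + (a - x3) * ((Re w)\<^sup>2 + (Im w)\<^sup>2)
      + 2 * (x1 * Re (cnj z * w) + x2 * Im (cnj z * w))" for z w
    using psd[unfolded pos_semidef_def herm_quadratic_form, THEN conjunct2, rule_format, of "vector [z, w]"]
    by (simp only: cmod_power2 vector_2 a_def x1_def x2_def x3_def)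
  have diag: "0 \<le> a + x3" "0 \<le> a - x3" using Q[of 1 0] Q[of 0 1] by simp_all
  define D where "D = (a + x3) * (a - x3) - (x1\<^sup>2 + x2\<^sup>2)"
  have "0 \<le> (a + x3) * (x1\<^sup>2 + x2\<^sup>2) + (a - x3) * c\<^sup>2 - 2 * c * (x1\<^sup>2 + x2\<^sup>2)" for c
    using Q[of "Complex x1 (- x2)" "- complex_of_real c"]
    by (simp add: power2_eq_square algebra_simps)
  note 1 = this
  have 2: "0 \<le> (a + x3) * c\<^sup>2 + (a - x3) * (x1\<^sup>2 + x2\<^sup>2) - 2 * c * (x1\<^sup>2 + x2\<^sup>2)" for c
    using Q[of "- complex_of_real c" "Complex x1 x2"]
    by (simp add: power2_eq_square algebra_simps)
  have "0 \<le> D"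
  proof (cases "a = 0")
    case True
    with diag have "x3 = 0" by simp
    with 1[of 1] True show ?thesis by (simp add: D_def)
  next
    case False
    have "0 \<le> (a + x3) * D" using 1[of "a + x3"] by (simp add: D_def power2_eq_square algebra_simps)
    moreover have "0 \<le> (a - x3) * D" using 2[of "a - x3"] by (simp add: D_def power2_eq_square algebra_simps)
    ultimately have "0 \<le> (a + x3) * D + (a - x3) * D" by simp
    also have "\<dots> = (2 * a) * D" by (simp add: algebra_simps)
    finally show ?thesis using False diag by (auto simp: zero_le_mult_iff)
  qed
  then show "p \<in> spin_cone"
    using diag by (simp add: spin_cone_iff spin_disc_def inner_3 D_def power2_eq_square algebra_simps
        flip: a_def x1_def x2_def x3_def)
next
  assume p: "p \<in> spin_cone"
  have "0 \<le> Re (\<Sum>i\<in>UNIV. cnj (z $ i) * (herm p *v z) $ i)" for z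
  proof -
    define N y where "N = (norm (z$1))\<^sup>2 + (norm (z$2))\<^sup>2"
      and "y = (vector [2 * Re (cnj (z$1) * z$2), 2 * Im (cnj (z$1) * z$2),
                (norm (z$1))\<^sup>2 - (norm (z$2))\<^sup>2] :: real^3)"
    define r m P Q where "r = Re (cnj (z$1) * z$2)" and "m = Im (cnj (z$1) * z$2)"
      and "P = (norm (z$1))\<^sup>2" and "Q = (norm (z$2))\<^sup>2"
    have rm: "r\<^sup>2 + m\<^sup>2 = P * Q"
      unfolding r_def m_def P_def Q_def cmod_power2[symmetric]
      by (simp add: norm_mult power_mult_distrib)
    have "y \<bullet> y = (2 * r) * (2 * r) + (2 * m) * (2 * m) + (P - Q) * (P - Q)"
      unfolding inner_3 y_def vector_3 r_def m_def P_def Q_def by (rule refl)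
    then have "(norm y)\<^sup>2 = 4 * (r\<^sup>2 + m\<^sup>2) + (P - Q)\<^sup>2"
      unfolding power2_norm_eq_inner by (simp add: power2_eq_square)
    also have "\<dots> = N\<^sup>2"
      unfolding rm by (simp add: N_def P_def[symmetric] Q_def[symmetric]) (simp add: power2_eq_square algebra_simps)
    finally have "norm y = N"
      by (simp add: N_def power2_eq_iff_nonneg)
    have "- (snd p \<bullet> y) \<le> norm (snd p) * norm y"
      using Cauchy_Schwarz_ineq2[of "snd p" y] by simp
    also have "\<dots> \<le> fst p * N"
      using p \<open>norm y = N\<close> by (auto simp: spin_cone_def intro!: mult_right_mono simp: N_def)
    finally have "0 \<le> fst p * N + snd p \<bullet> y" by simp
    then show ?thesis
      unfolding herm_quadratic_form by (simp add: N_def y_def inner_3 algebra_simps)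
  qed
  then show "pos_semidef (herm p)" by (simp add: pos_semidef_def)
qed

lemma effects_eq_herm: "effects = herm ` spin_effects"
proof -
  have "herm p \<in> effects \<longleftrightarrow> p \<in> spin_effects" for p
    by (simp add: effects_def loewner_le_def mat_1_eq_herm herm_diff pos_semidef_herm_iff
        spin_effects_def)
  moreover have "A \<in> herm ` UNIV" if "A \<in> effects" for A
  proof -
    have "self_adjoint A" using that by (simp add: effects_def pos_semidef_def)
    then show ?thesis by (metis herm_bloch rangeI)
  qed
  ultimately show ?thesis by blast
qed

lemma herm_triple:
  "herm (s, u) ** herm (b, y) ** herm (s, u) =
    herm (b * (s\<^sup>2 + u \<bullet> u) + 2 * s * (u \<bullet> y),
      (2 * s * b) *\<^sub>R u + (s\<^sup>2 - u \<bullet> u) *\<^sub>R y + (2 * (u \<bullet> y)) *\<^sub>R u)"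
  by (simp add: mat2_eq_iff mat2_mult_entries complex_eq_iff inner_3 power2_eq_square algebra_simps)

lemma herm_square: "herm (s, u) ** herm (s, u) = herm (s\<^sup>2 + u \<bullet> u, (2 * s) *\<^sub>R u)"
  by (simp add: mat2_eq_iff mat2_mult_entries complex_eq_iff inner_3 power2_eq_square algebra_simps)

text \<open>
  The square of \<open>(s, u)\<close> is \<open>(s\<^sup>2 + \<bar>u\<bar>\<^sup>2, 2 s u)\<close>, and its determinant is the square of
  \<open>s\<^sup>2 - \<bar>u\<bar>\<^sup>2 \<ge> 0\<close>. Trace and determinant of the square therefore determine \<open>s\<close>, and then \<open>u\<close>.
\<close>

lemma pos_sqrt_herm:
  assumes p: "p \<in> spin_cone"
  defines "d \<equiv> sqrt (spin_disc p)"
  obtains s u where "pos_sqrt (herm p) = herm (s, u)" "fst p = s\<^sup>2 + u \<bullet> u" "snd p = (2 * s) *\<^sub>R u"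
    "d = s\<^sup>2 - u \<bullet> u" "norm u \<le> s"
proof -
  have d: "0 \<le> d" "d\<^sup>2 = (fst p)\<^sup>2 - snd p \<bullet> snd p"
    using p by (auto simp: d_def spin_cone_iff) (simp add: spin_disc_def)
  have a: "0 \<le> fst p" using p by (simp add: spin_cone_iff)
  define s where "s = sqrt ((fst p + d) / 2)"
  define u where "u = snd p /\<^sub>R (2 * s)"
  have s: "0 \<le> s" "2 * s\<^sup>2 = fst p + d" using a d by (simp_all add: s_def)
  have root: "s' = s \<and> u' = u \<and> d = s'\<^sup>2 - u' \<bullet> u'"
    if "norm u' \<le> s'" "fst p = s'\<^sup>2 + u' \<bullet> u'" "snd p = (2 * s') *\<^sub>R u'" for s' u'
  proof -
    have s': "0 \<le> s'" using that(1) norm_ge_zero order_trans by blast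
    have "u' \<bullet> u' \<le> s'\<^sup>2" using power_mono[OF that(1), of 2] by (simp add: power2_norm_eq_inner)
    moreover have "d\<^sup>2 = (s'\<^sup>2 - u' \<bullet> u')\<^sup>2"
      unfolding d(2) that(2,3) by (simp add: power2_eq_square algebra_simps)
    ultimately have ds: "d = s'\<^sup>2 - u' \<bullet> u'" using d(1) by (simp add: power2_eq_iff_nonneg)
    then have "s'\<^sup>2 = s\<^sup>2" using s(2) that(2) by simp
    then have "s' = s" using s s' by (simp add: power2_eq_iff_nonneg)
    moreover have "u' = u"
    proof (cases "s' = 0")
      case True with that(1) show ?thesis by (simp add: u_def that(3))
    next
      case False then show ?thesis by (simp add: u_def that(3) flip: \<open>s' = s\<close>)
    qed
    ultimately show ?thesis using ds by simp
  qed
  have su: "norm u \<le> s" "fst p = s\<^sup>2 + u \<bullet> u" "snd p = (2 * s) *\<^sub>R u"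
  proof -
    have X: "snd p \<bullet> snd p = (fst p - d) * (fst p + d)"
      using d(2) by (simp add: power2_eq_square algebra_simps)
    have uu: "u \<bullet> u = (fst p - d) / 2 \<and> snd p = (2 * s) *\<^sub>R u"
    proof (cases "s = 0")
      case True
      with s a d have "fst p = 0" "d = 0" by auto
      with X show ?thesis by (simp add: u_def True)
    next
      case False
      then have su: "snd p = (2 * s) *\<^sub>R u" by (simp add: u_def)
      have "(2 * s\<^sup>2) * (2 * (u \<bullet> u)) = snd p \<bullet> snd p"
        unfolding su by (simp add: power2_eq_square)
      also have "\<dots> = (2 * s\<^sup>2) * (fst p - d)" unfolding X s(2) by simp
      finally have "2 * (u \<bullet> u) = fst p - d"
        using False by (metis mult_left_cancel mult_eq_0_iff zero_neq_numeral power_eq_0_iff)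
      with su show ?thesis by simp
    qed
    then show "fst p = s\<^sup>2 + u \<bullet> u" "snd p = (2 * s) *\<^sub>R u" using s(2) by auto
    have "u \<bullet> u \<le> s\<^sup>2" using uu s(2) d(1) by simp
    then show "norm u \<le> s"
      using power2_le_imp_le[of "norm u" s] s(1) by (simp add: power2_norm_eq_inner)
  qed
  have "pos_sqrt (herm p) = herm (s, u)"
    unfolding pos_sqrt_def
  proof (rule the_equality)
    show "pos_semidef (herm (s, u)) \<and> herm (s, u) ** herm (s, u) = herm p"
      using su by (simp add: pos_semidef_herm_iff spin_cone_def herm_square prod_eq_iff)
  next
    fix S assume S: "pos_semidef S \<and> S ** S = herm p"
    then obtain s' u' where S': "S = herm (s', u')"
      using herm_bloch[of S] by (metis pos_semidef_def surj_pair)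
    have "norm u' \<le> s'" using S unfolding S' by (simp add: pos_semidef_herm_iff spin_cone_def)
    moreover have "(s'\<^sup>2 + u' \<bullet> u', (2 * s') *\<^sub>R u') = p"
      using S unfolding S' herm_square herm_inject by blast
    then have "fst p = s'\<^sup>2 + u' \<bullet> u'" "snd p = (2 * s') *\<^sub>R u'" by auto
    ultimately show "S = herm (s, u)" using root[of u' s'] by (simp only: S')
  qed
  with that su root[OF su] show ?thesis by blast
qed

lemma seq_prod_herm:
  assumes "p \<in> spin_cone"
  shows "herm p \<circ>\<^sub>s herm q = herm (spin_prod p q)"
proof -
  obtain s u where su: "pos_sqrt (herm p) = herm (s, u)" "fst p = s\<^sup>2 + u \<bullet> u" "snd p = (2 * s) *\<^sub>R u"
    "sqrt (spin_disc p) = s\<^sup>2 - u \<bullet> u" "norm u \<le> s"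
    using pos_sqrt_herm[OF assms] by metis
  obtain b y where q: "q = (b, y)" by fastforce
  have "(snd p \<bullet> y / (fst p + sqrt (spin_disc p))) *\<^sub>R snd p = (2 * (u \<bullet> y)) *\<^sub>R u"
  proof (cases "s = 0")
    case True with su(5) show ?thesis by (simp add: su(3))
  next
    case False
    then show ?thesis unfolding su(2-4) by (simp add: power2_eq_square)
  qed
  then show ?thesis
    unfolding seq_prod_def su(1) q herm_triple spin_prod_def fst_conv snd_conv
    by (simp only:) (simp add: su(2,3,4) algebra_simps)
qed

section \<open>Isometries of space as unitary conjugations\<close>

lemma conj_transpose_mult: "conj_transpose (A ** B) = conj_transpose B ** conj_transpose A"
  by (simp add: vec_eq_iff conj_transpose_entries matrix_matrix_mult_def cnj_sum mult.commute)

lemma conj_transpose_conj_transpose [simp]: "conj_transpose (conj_transpose A) = A"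
  by (simp add: vec_eq_iff conj_transpose_entries)

definition conj_by :: "complex^'n^'n \<Rightarrow> complex^'n^'n \<Rightarrow> complex^'n^'n" where
  "conj_by U A = U ** A ** conj_transpose U"

lemma conj_by_mult: "conj_by (U ** V) A = conj_by U (conj_by V A)"
  by (simp add: conj_by_def conj_transpose_mult matrix_mul_assoc)

lemma unitary_conj_transpose: "unitary_matrix U \<Longrightarrow> unitary_matrix (conj_transpose U)"
  by (simp add: unitary_matrix_def)

lemma unitary_mult:
  assumes "unitary_matrix U" "unitary_matrix V"
  shows "unitary_matrix (U ** V)"
proof -
  have "(U ** V) ** conj_transpose (U ** V) = U ** (V ** conj_transpose V) ** conj_transpose U"
    "conj_transpose (U ** V) ** (U ** V) = conj_transpose V ** (conj_transpose U ** U) ** V"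
    by (simp_all only: conj_transpose_mult matrix_mul_assoc)
  then show ?thesis using assms by (simp add: unitary_matrix_def)
qed

lemma conj_by_inverse:
  assumes "unitary_matrix U"
  shows "conj_by U (conj_by (conj_transpose U) A) = A"
proof -
  have "conj_by U (conj_by (conj_transpose U) A) = (U ** conj_transpose U) ** A ** (U ** conj_transpose U)"
    by (simp add: conj_by_def matrix_mul_assoc)
  then show ?thesis using assms by (simp add: unitary_matrix_def)
qed

lemma linear_conj_by: "linear (conj_by U)" for U :: "complex^2^2"
  by (intro linearI) (simp_all add: conj_by_def mat2_eq_iff mat2_mult_entries algebra_simps)

text \<open>
  Conjugation by a unitary matrix fixes the identity and preserves trace and determinant.
\<close>

lemma conj_by_herm:
  assumes U: "unitary_matrix U"
  obtains T where "linear T" "\<And>x. norm (T x) = norm x" "\<And>a x. conj_by U (herm (a, x)) = herm (a, T x)"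
proof -
  define T where "T x = snd (bloch (conj_by U (herm (0, x))))" for x
  have UU: "conj_transpose U ** U = mat 1" "U ** conj_transpose U = mat 1"
    using U by (simp_all add: unitary_matrix_def)
  have sa: "self_adjoint (conj_by U (herm p))" for p
    using self_adjoint_herm[of p]
    by (simp add: self_adjoint_def conj_by_def conj_transpose_mult matrix_mul_assoc)
  have trace: "fst (bloch A) = Re (trace A) / 2" for A
    by (simp add: bloch_def trace_def sum_2)
  have trace_conj: "trace (conj_by U A) = trace A" for A
    unfolding conj_by_def by (subst trace_mul_sym) (simp add: matrix_mul_assoc UU)
  have fst: "fst (bloch (conj_by U (herm (0, x)))) = 0" for x
    unfolding trace trace_conj by (simp add: trace_def sum_2)
  have T: "conj_by U (herm (0, x)) = herm (0, T x)" for x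
    using herm_bloch[OF sa, of "(0, x)"] fst[of x] unfolding T_def by (metis prod.collapse)
  have one: "conj_by U (herm (1, 0)) = herm (1, 0)"
    by (simp add: conj_by_def UU flip: mat_1_eq_herm)
  have form: "conj_by U (herm (a, x)) = herm (a, T x)" for a x
  proof -
    have herm: "herm (a, y) = a *\<^sub>R herm (1, 0) + herm (0, y)" for y
      using linear_add[OF linear_herm, of "a *\<^sub>R (1, 0)" "(0, y)"]
      by (simp add: linear_scale[OF linear_herm] del: scaleR_Pair) simp
    show ?thesis
      unfolding herm[of x] herm[of "T x"]
      by (simp only: linear_add[OF linear_conj_by] linear_scale[OF linear_conj_by] one T)
  qed
  have "linear T"
  proof (rule linearI)
    show "T (x + y) = T x + T y" for x y
      using linear_add[OF linear_herm, of "(0, x)" "(0, y)"]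
      by (simp add: T_def linear_add[OF linear_conj_by] linear_add[OF linear_bloch])
    show "T (c *\<^sub>R x) = c *\<^sub>R T x" for c x
      using linear_scale[OF linear_herm, of c "(0, x)"]
      by (simp add: T_def linear_scale[OF linear_conj_by] linear_scale[OF linear_bloch])
  qed
  moreover have "norm (T x) = norm x" for x
  proof -
    have "det U * det (conj_transpose U) = 1" using UU(2) by (metis det_I det_mul)
    then have "det (conj_by U A) = det A" for A
      by (simp add: conj_by_def det_mul mult.commute mult.left_commute)
    then have "det (herm (0, T x)) = det (herm (0, x))" by (metis T)
    then show ?thesis by (simp add: det_herm spin_disc_def norm_eq_sqrt_inner)
  qed
  ultimately show ?thesis using that form by blast
qed

text \<open>
  The columns of \<open>U\<close> are orthonormal eigenvectors of \<open>n \<cdot> \<sigma>\<close>; its entries are half-angle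
  expressions of \<open>n\<close>, with a separate choice at the south pole.
\<close>

lemma ex_unitary_conj_axis_3:
  fixes n :: "real^3"
  assumes "norm n = 1"
  obtains U where "unitary_matrix U" "\<And>a t. conj_by U (herm (a, t *\<^sub>R axis 3 1)) = herm (a, t *\<^sub>R n)"
proof -
  have n: "(n$1)\<^sup>2 + (n$2)\<^sup>2 + (n$3)\<^sup>2 = 1"
    using assms by (simp add: norm_eq_sqrt_inner inner_3 power2_eq_square)
  have "\<exists>r b c. r\<^sup>2 + (b\<^sup>2 + c\<^sup>2) = 1 \<and> r\<^sup>2 - (b\<^sup>2 + c\<^sup>2) = n$3 \<and> 2 * r * b = n$1 \<and> 2 * r * c = n$2"
  proof (cases "n$3 = -1")
    case True
    with n have "n$1 = 0" "n$2 = 0" by (simp_all add: sum_power2_eq_zero_iff)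
    with True show ?thesis by (intro exI[of _ 0] exI[of _ 1]) simp
  next
    case False
    have "(n$3)\<^sup>2 \<le> 1" using n zero_le_power2[of "n$1"] zero_le_power2[of "n$2"] by linarith
    then have pos: "0 < 1 + n$3" using False by (simp add: abs_square_le_1)
    define r where "r = sqrt ((1 + n$3) / 2)"
    have r: "r \<noteq> 0" "2 * r\<^sup>2 = 1 + n$3" using pos by (simp_all add: r_def)
    define q where "q = (n$1 / (2 * r))\<^sup>2 + (n$2 / (2 * r))\<^sup>2"
    have "(2 * r\<^sup>2) * (2 * q) = (n$1)\<^sup>2 + (n$2)\<^sup>2"
      using r(1) by (simp add: q_def power_divide power_mult_distrib field_simps)
    also have "\<dots> = (2 * r\<^sup>2) * (1 - n$3)" using n unfolding r(2) by (simp add: power2_eq_square algebra_simps)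
    finally have "2 * q = 1 - n$3" using r(1) by (metis mult_left_cancel mult_eq_0_iff zero_neq_numeral power_eq_0_iff)
    with r show ?thesis
      by (intro exI[of _ r] exI[of _ "n$1 / (2 * r)"] exI[of _ "n$2 / (2 * r)"]) (simp flip: q_def)
  qed
  then obtain r b c where rbc: "r\<^sup>2 + (b\<^sup>2 + c\<^sup>2) = 1" "r\<^sup>2 - (b\<^sup>2 + c\<^sup>2) = n$3" "n$1 = 2 * r * b" "n$2 = 2 * r * c"
    by metis
  define U :: "complex^2^2" where
    "U = vector [vector [of_real r, Complex (- b) c], vector [Complex b c, of_real r]]"
  have one: "r * r + (b * b + c * c) = 1" using rbc(1) by (simp add: power2_eq_square)
  have "unitary_matrix U"
    using one by (simp add: unitary_matrix_def mat2_eq_iff mat2_mult_entries conj_transpose_entries U_def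
        mat_def complex_eq_iff algebra_simps)
  moreover have "conj_by U (herm (a, t *\<^sub>R axis 3 1)) = herm (a, t *\<^sub>R n)" for a t
  proof -
    have "a * (r * r + (b * b + c * c)) = a" by (simp add: one)
    then have a: "a * (r * r) + (a * (b * b) + a * (c * c)) = a" by (simp add: algebra_simps)
    show ?thesis using a
      by (simp add: conj_by_def mat2_eq_iff mat2_mult_entries conj_transpose_entries U_def
        rbc(3,4) rbc(2)[symmetric] complex_eq_iff axis_def power2_eq_square algebra_simps)
  qed
  ultimately show ?thesis using that by blast
qed

text \<open>
  After a unitary conjugation the isometry fixes the third axis. On the plane of the first two axes it is then a
  rotation, the conjugation by the diagonal matrix \<open>D\<close>, or such a rotation after a reflection. The
  reflection that reverses the second axis is the negative of the half-turn about that axis, and the half-turn is the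
  conjugation by the second Pauli matrix \<open>K\<close>.
\<close>

lemma isometry_conj_by_unitary:
  fixes R :: "real^3 \<Rightarrow> real^3"
  assumes lin: "linear R" and iso: "\<And>x. norm (R x) = norm x"
  shows "\<exists>U. unitary_matrix U \<and> ((\<forall>a x. herm (a, R x) = conj_by U (herm (a, x))) \<or>
    (\<forall>a x. herm (a, R x) = conj_by U (herm (a, - x))))"
proof -
  define e where "e i = (axis i 1 :: real^3)" for i
  obtain U0 where U0: "unitary_matrix U0"
    and axis: "\<And>a t. conj_by U0 (herm (a, t *\<^sub>R e 3)) = herm (a, t *\<^sub>R R (e 3))"
    using ex_unitary_conj_axis_3[of "R (e 3)"] by (metis e_def iso norm_axis_1)
  obtain T where T: "linear T" "\<And>x. norm (T x) = norm x"
    and conj: "\<And>a x. conj_by (conj_transpose U0) (herm (a, x)) = herm (a, T x)"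
    using conj_by_herm[OF unitary_conj_transpose[OF U0]] by metis
  define Q where "Q x = T (R x)" for x
  have "orthogonal_transformation Q"
    unfolding orthogonal_transformation Q_def
    using linear_compose[OF lin T(1)] iso T(2) by (simp add: o_def)
  then have Q: "linear Q" "\<And>x y. Q x \<bullet> Q y = x \<bullet> y" by (auto simp: orthogonal_transformation_def)
  have R: "herm (a, R x) = conj_by U0 (herm (a, Q x))" for a x
    using conj_by_inverse[OF U0, of "herm (a, R x)"] by (simp add: conj Q_def)
  have Q3: "Q (e 3) = e 3"
  proof -
    have "conj_by U0 (herm (0, Q (e 3))) = conj_by U0 (herm (0, e 3))"
      using R[of 0 "e 3"] axis[of 0 1] by simp
    then have "conj_by (conj_transpose U0) (conj_by U0 (herm (0, Q (e 3))))
      = conj_by (conj_transpose U0) (conj_by U0 (herm (0, e 3)))" by simp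
    then show ?thesis
      using conj_by_inverse[OF unitary_conj_transpose[OF U0]] by simp
  qed
  define c s p q where "c = Q (e 1) $ 1" and "s = Q (e 1) $ 2" and "p = Q (e 2) $ 1" and "q = Q (e 2) $ 2"
  have z: "Q (e 1) $ 3 = 0" "Q (e 2) $ 3 = 0"
    using Q(2)[of "e 1" "e 3"] Q(2)[of "e 2" "e 3"] by (simp_all add: Q3) (simp_all add: inner_3 e_def axis_def)
  have cs: "c * c + s * s = 1" and pq: "p * p + q * q = 1" and cspq: "c * p + s * q = 0"
    using Q(2)[of "e 1" "e 1"] Q(2)[of "e 2" "e 2"] Q(2)[of "e 1" "e 2"]
    by (simp_all add: inner_3 z c_def s_def p_def q_def) (simp_all add: e_def axis_def)
  define d where "d = c * q - s * p"
  have pd: "p = - s * d" and qd: "q = c * d"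
  proof -
    show "p = - s * d" "q = c * d" using cs cspq unfolding d_def by algebra+
  qed
  have "d * d = 1"
    using pq cs unfolding pd qd by algebra
  then have d: "d = 1 \<or> d = -1" by (simp add: square_eq_1_iff)
  have Qx: "Q x = vector [c * x$1 + p * x$2, s * x$1 + q * x$2, x$3]" for x
  proof -
    have "x = x$1 *\<^sub>R e 1 + x$2 *\<^sub>R e 2 + x$3 *\<^sub>R e 3"
      by (simp add: vec_eq_iff forall_3 e_def axis_def)
    then have "Q x = x$1 *\<^sub>R Q (e 1) + x$2 *\<^sub>R Q (e 2) + x$3 *\<^sub>R e 3"
      using Q(1) Q3 linear_add[OF Q(1)] linear_scale[OF Q(1)] by (metis (no_types))
    then show ?thesis
      by (simp add: vec_eq_iff forall_3 z flip: c_def s_def p_def q_def) (simp add: e_def axis_def)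
  qed
  define D K :: "complex^2^2" where "D = vector [vector [1, 0], vector [0, Complex c s]]"
    and "K = vector [vector [0, - \<i>], vector [\<i>, 0]]"
  have DK: "unitary_matrix D" "unitary_matrix K"
    using cs by (simp_all add: unitary_matrix_def mat2_eq_iff mat2_mult_entries conj_transpose_entries
        D_def K_def mat_def complex_eq_iff algebra_simps)
  have K: "conj_by K (herm (a, x)) = herm (a, vector [- x$1, x$2, - x$3])" for a x
    by (simp add: conj_by_def mat2_eq_iff mat2_mult_entries conj_transpose_entries K_def complex_eq_iff)
  have D: "conj_by D (herm (a, x)) = herm (a, vector [c * x$1 - s * x$2, s * x$1 + c * x$2, x$3])" for a x
  proof -
    have "(a - x$3) * (c * c + s * s) = a - x$3" by (simp add: cs)
    then show ?thesis
      by (simp add: conj_by_def mat2_eq_iff mat2_mult_entries conj_transpose_entries D_def complex_eq_iff algebra_simps)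
  qed
  from d show ?thesis
  proof
    assume "d = 1"
    then have "herm (a, R x) = conj_by (U0 ** D) (herm (a, x))" for a x
      by (simp add: R conj_by_mult D Qx pd qd)
    then show ?thesis using unitary_mult[OF U0 DK(1)] by blast
  next
    assume "d = -1"
    then have "herm (a, R x) = conj_by (U0 ** (D ** K)) (herm (a, - x))" for a x
      by (simp add: R conj_by_mult D K Qx pd qd)
    then show ?thesis using unitary_mult[OF U0 unitary_mult[OF DK]] by blast
  qed
qed

section \<open>Continuous sequential endomorphisms\<close>

lemma adj2_herm: "adj2 (herm p) = herm (fst p, - snd p)"
  by (simp add: adj2_def mat2_eq_iff complex_eq_iff)

lemma invertible_herm_iff: "invertible (herm p) \<longleftrightarrow> spin_disc p \<noteq> 0"
  by (simp add: invertible_det_nz det_herm)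

lemma matrix_inv_herm:
  assumes "spin_disc p \<noteq> 0"
  shows "matrix_inv (herm p) = inverse (spin_disc p) *\<^sub>R herm (fst p, - snd p)"
proof -
  let ?B = "inverse (spin_disc p) *\<^sub>R herm (fst p, - snd p)"
  have "herm p ** herm (fst p, - snd p) = herm (spin_disc p, 0)"
    by (simp add: mat2_eq_iff mat2_mult_entries complex_eq_iff spin_disc_def inner_3
        power2_eq_square algebra_simps)
  moreover have "herm p ** ?B = inverse (spin_disc p) *\<^sub>R (herm p ** herm (fst p, - snd p))"
    by (simp add: mat2_eq_iff mat2_mult_entries algebra_simps)
  ultimately have B: "herm p ** ?B = mat 1"
    using assms by (simp add: herm_scaleR mat_1_eq_herm)
  have "invertible (herm p)" using assms by (simp add: invertible_herm_iff)
  then have inv: "matrix_inv (herm p) ** herm p = mat 1"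
    unfolding invertible_def matrix_inv_def by (rule someI_ex[THEN conjunct2])
  have "matrix_inv (herm p) = matrix_inv (herm p) ** (herm p ** ?B)" by (simp add: B)
  also have "\<dots> = (matrix_inv (herm p) ** herm p) ** ?B" by (simp only: matrix_mul_assoc)
  also have "\<dots> = ?B" by (simp add: inv)
  finally show ?thesis .
qed

lemma det_pow_herm: "det_pow (herm p) c = rpow (spin_disc p) c"
  by (simp add: det_pow_def rpow_def det_herm)

lemma conj_by_scaleR: "conj_by U (c *\<^sub>R A) = c *\<^sub>R conj_by U A" for U :: "complex^2^2"
  by (rule linear_scale[OF linear_conj_by])

lemma diag2_eq_herm: "diag2 a b = herm ((a + b) / 2, ((a - b) / 2) *\<^sub>R axis 3 1)"
  by (simp add: diag2_def mat2_eq_iff complex_eq_iff axis_def field_simps)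

theorem theorem3:
  fixes \<phi> :: "complex^2^2 \<Rightarrow> complex^2^2"
  assumes "cont_seq_endo \<phi>"
  shows
    "(\<exists>U c. unitary_matrix U \<and> c \<ge> 0 \<and>
        (\<forall>A\<in>effects. \<phi> A = det_pow A c *\<^sub>R (U ** A ** conj_transpose U))) \<or>
     (\<exists>V. unitary_matrix V \<and>
        (\<forall>A\<in>effects. \<phi> A = V ** adj2 A ** conj_transpose V)) \<or>
     (\<exists>V d. unitary_matrix V \<and> d > 1 \<and>
        (\<forall>A\<in>effects. \<phi> A =
           (if invertible A then det_pow A d *\<^sub>R (V ** matrix_inv A ** conj_transpose V) else 0))) \<or>
     (\<exists>W c1 c2. unitary_matrix W \<and> c1 \<ge> 0 \<and> c2 \<ge> 0 \<and>
        (\<forall>A\<in>effects. \<phi> A = W ** diag2 (det_pow A c1) (det_pow A c2) ** conj_transpose W)) \<or>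
     \<comment> \<open>the remaining, non-unital maps, of rank at most one\<close>
     (\<exists>W c. unitary_matrix W \<and> c \<ge> 0 \<and>
        (\<forall>A\<in>effects. \<phi> A = W ** diag2 (det_pow A c) 0 ** conj_transpose W)) \<or>
     (\<forall>A\<in>effects. \<phi> A = 0)"
proof -
  define \<psi> where "\<psi> p = bloch (\<phi> (herm p))" for p
  have \<phi>: "\<phi> (herm p) = herm (\<psi> p) \<and> \<psi> p \<in> spin_effects" if "p \<in> spin_effects" for p
  proof -
    have "\<phi> (herm p) \<in> herm ` spin_effects"
      using assms that by (auto simp: cont_seq_endo_def effects_eq_herm)
    then show ?thesis by (auto simp: \<psi>_def)
  qed
  have maps: "\<And>p. p \<in> spin_effects \<Longrightarrow> \<psi> p \<in> spin_effects" using \<phi> by blast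
  have cont: "continuous_on spin_effects \<psi>"
  proof -
    have "continuous_on (herm ` spin_effects) \<phi>"
      using assms by (simp add: cont_seq_endo_def effects_eq_herm)
    from continuous_on_compose[OF continuous_on_compose[OF continuous_on_herm this] continuous_on_bloch]
    show ?thesis by (simp add: \<psi>_def o_def cong: continuous_on_cong)
  qed
  have cone: "p \<in> spin_effects \<Longrightarrow> p \<in> spin_cone" for p :: "real \<times> (real^3)"
    by (simp add: spin_effects_def)
  have mult: "\<psi> (spin_prod p q) = spin_prod (\<psi> p) (\<psi> q)"
    if pq: "p \<in> spin_effects" "q \<in> spin_effects" for p q
  proof -
    have "\<phi> (herm p \<circ>\<^sub>s herm q) = \<phi> (herm p) \<circ>\<^sub>s \<phi> (herm q)"
      using assms pq by (auto simp: cont_seq_endo_def effects_eq_herm)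
    then have "herm (\<psi> (spin_prod p q)) = herm (spin_prod (\<psi> p) (\<psi> q))"
      using pq \<phi> by (simp add: seq_prod_herm cone spin_prod_mem_effects)
    then show ?thesis by simp
  qed
  have dim: "2 \<le> DIM(real^3)" by simp
  have one: "(1, 0) \<in> spin_effects" by (simp add: spin_effects_iff)
  have "spin_prod (\<psi> (1, 0)) (\<psi> (1, 0)) = \<psi> (1, 0)"
    using mult[OF one one] by simp
  with spin_prod_idempotent[OF cone[OF maps[OF one]]]
  consider "\<psi> (1, 0) = (1, 0)" | "\<psi> (1, 0) = 0"
    | n where "norm n = 1" "\<psi> (1, 0) = (1 / 2) *\<^sub>R (1, n)" by blast
  then show ?thesis
  proof cases
    case 2
    have "\<psi> p = 0" if "p \<in> spin_effects" for p
      using mult[OF one that] by (simp add: 2) (simp add: spin_prod_def spin_disc_def zero_prod_def)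
    moreover have "herm 0 = 0" using linear_herm by (rule linear_0)
    ultimately have "\<forall>A\<in>effects. \<phi> A = 0" using \<phi> by (auto simp: effects_eq_herm)
    then show ?thesis by blast
  next
    case (3 n)
    obtain c where c: "0 \<le> c" and \<psi>: "\<And>p. p \<in> spin_effects \<Longrightarrow> \<psi> p = (rpow (spin_disc p) c / 2) *\<^sub>R (1, n)"
      using rank_one_spin_endo[OF dim maps cont mult 3] by blast
    obtain W where W: "unitary_matrix W" "\<And>a t. conj_by W (herm (a, t *\<^sub>R axis 3 1)) = herm (a, t *\<^sub>R n)"
      using ex_unitary_conj_axis_3[OF 3(1)] by blast
    have "\<phi> A = W ** diag2 (det_pow A c) 0 ** conj_transpose W" if A: "A \<in> effects" for A
    proof -
      obtain p where p: "p \<in> spin_effects" "A = herm p" using A by (auto simp: effects_eq_herm)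
      then have "\<phi> A = conj_by W (diag2 (det_pow A c) 0)"
        using \<phi>[OF p(1)] by (simp add: \<psi> det_pow_herm diag2_eq_herm W(2))
      then show ?thesis by (simp add: conj_by_def)
    qed
    with W(1) c show ?thesis by blast
  next
    case 1
    interpret unital_spin_endo \<psi>
      by standard (use maps cont mult 1 in auto)
    from classification[OF dim] show ?thesis
    proof (elim disjE exE conjE)
      fix c1 c2 and n :: "real^3" assume c: "0 \<le> c1" "0 \<le> c2" and n: "norm n = 1"
        and \<psi>: "\<forall>p\<in>spin_effects. \<psi> p = ((rpow (spin_disc p) c1 + rpow (spin_disc p) c2) / 2,
         ((rpow (spin_disc p) c1 - rpow (spin_disc p) c2) / 2) *\<^sub>R n)"
      obtain W where W: "unitary_matrix W" "\<And>a t. conj_by W (herm (a, t *\<^sub>R axis 3 1)) = herm (a, t *\<^sub>R n)"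
        using ex_unitary_conj_axis_3[OF n] by blast
      have "\<phi> A = W ** diag2 (det_pow A c1) (det_pow A c2) ** conj_transpose W" if A: "A \<in> effects" for A
      proof -
        obtain p where p: "p \<in> spin_effects" "A = herm p" using A by (auto simp: effects_eq_herm)
        then have "\<phi> A = conj_by W (diag2 (det_pow A c1) (det_pow A c2))"
          using \<phi>[OF p(1)] \<psi> by (simp add: det_pow_herm diag2_eq_herm W(2))
        then show ?thesis by (simp add: conj_by_def)
      qed
      with W(1) c show ?thesis by blast
    next
      fix c R assume c: "0 \<le> c" and R: "linear R" "\<forall>v. norm (R v) = norm v"
        and \<psi>: "\<forall>p\<in>spin_effects. \<psi> p = rpow (spin_disc p) c *\<^sub>R (fst p, R (snd p))"
      have \<phi>_R: "\<phi> (herm p) = rpow (spin_disc p) c *\<^sub>R herm (fst p, R (snd p))" if "p \<in> spin_effects" for p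
        using \<phi>[OF that] \<psi> that by (simp add: herm_scaleR)
      obtain U where U: "unitary_matrix U" and "(\<forall>a x. herm (a, R x) = conj_by U (herm (a, x))) \<or>
        (\<forall>a x. herm (a, R x) = conj_by U (herm (a, - x)))"
        using isometry_conj_by_unitary[OF R(1)] R(2) by blast
      then consider (rotated) "\<And>a x. herm (a, R x) = conj_by U (herm (a, x))"
        | (reflected) "\<And>a x. herm (a, R x) = conj_by U (herm (a, - x))" by blast
      then show ?thesis
      proof cases
        case rotated
        have "\<phi> A = det_pow A c *\<^sub>R (U ** A ** conj_transpose U)" if "A \<in> effects" for A
          using that by (auto simp: effects_eq_herm \<phi>_R rotated det_pow_herm conj_by_def)
        with U c show ?thesis by blast
      next
        case reflected
        have \<phi>_adj: "\<phi> A = det_pow A c *\<^sub>R conj_by U (adj2 A)" if "A \<in> effects" for A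
          using that by (auto simp: effects_eq_herm \<phi>_R reflected det_pow_herm adj2_herm)
        show ?thesis
        proof (cases "c = 0")
          case True
          then have "\<phi> A = U ** adj2 A ** conj_transpose U" if "A \<in> effects" for A
            using \<phi>_adj[OF that] by (simp add: det_pow_def conj_by_def)
          with U show ?thesis by blast
        next
          case False
          have "\<phi> A = (if invertible A then det_pow A (c + 1) *\<^sub>R (U ** matrix_inv A ** conj_transpose U) else 0)"
            if "A \<in> effects" for A
          proof -
            obtain p where p: "p \<in> spin_effects" "A = herm p" using \<open>A \<in> effects\<close> by (auto simp: effects_eq_herm)
            have "0 \<le> spin_disc p" using cone[OF p(1)] by (simp add: spin_cone_iff)
            show ?thesis
            proof (cases "spin_disc p = 0")
              case True
              then show ?thesis using False \<phi>_adj[OF that]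
                by (simp add: p(2) invertible_herm_iff det_pow_herm rpow_def)
            next
              case disc: False
              have "rpow (spin_disc p) (c + 1) * inverse (spin_disc p) = rpow (spin_disc p) c"
                using disc \<open>0 \<le> spin_disc p\<close> c False by (simp add: rpow_def powr_add)
              then have "det_pow A (c + 1) *\<^sub>R conj_by U (matrix_inv A) = det_pow A c *\<^sub>R conj_by U (adj2 A)"
                using disc by (simp add: p(2) matrix_inv_herm conj_by_scaleR adj2_herm det_pow_herm)
              then show ?thesis using disc \<phi>_adj[OF that]
                by (simp add: p(2) invertible_herm_iff conj_by_def)
            qed
          qed
          moreover have "1 < c + 1" using c False by simp
          ultimately show ?thesis using U by blast
        qed
      qed
    qed
  qed
qed

end
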